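(* Let $\Gamma$ be a discrete group and let $E$ be a Banach $\Gamma$-module. For every $n\in\mathbb{N}$, the following assertions are equivalent: (1) $H^n_a(\Gamma;E)=0$. (2) $H^n_b(\Gamma;E)=0$ and $H^{n+1}_b(\Gamma;E)$ is Hausdorff.
   Context: $\mathbb{N}$ is the set of positive integers, and $\mathcal{U}$ is a fixed non-principal ultrafilter on $\mathbb{N}$. A Banach $\Gamma$-module is a Banach space $E$ with an action of $\Gamma$ by linear isometries. Bounded cohomology: for $n\ge0$ let $C^n_b(\Gamma;E)=\ell^\infty(\Gamma^n,E)$ be the Banach space of bounded maps $\Gamma^n\to E$ with the supremum norm (so it is $E$ for $n=0$). For $n\geq1$ the codifferential $d^n:C^{n-1}_b(\Gamma;E)\to C^n_b(\Gamma;E)$ is $$d^nf(\gamma_1,\dots,\gamma_n)=\gamma_1\cdot f(\gamma_2,\dots,\gamma_n)+\sum_{i=1}^{n-1}(-1)^if(\gamma_1,\dots,\gamma_i\gamma_{i+1},\dots,\gamma_n)+(-1)^nf(\gamma_1,\dots,\gamma_{n-1}).$$ Then $H^n_b(\Gamma;E)=\ker d^{n+1}/\operatorname{im}d^n$, called Hausdorff if its quotient topology is Hausdorff. Ultrapowers: for a Banach space $V$, $V^{\mathcal{U}}$ is the Banach space obtained as the quotient of the space of bounded sequences $(x_k)_{k\in\mathbb{N}}$ in $V$ by the subspace of those with $\lim_{\mathcal{U}}\|x_k\|=0$, with norm $\|[x_k]\|_{\mathcal{U}}=\lim_{\mathcal{U}}\|x_k\|$. A bounded linear map $f:V\to W$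 induces $f_{\mathcal{U}}:V^{\mathcal{U}}\to W^{\mathcal{U}}$, $[x_k]\mapsto[f(x_k)]$. Diagonal asymptotic cohomology: $H^n_a(\Gamma;E)$ denotes the asymptotic cohomology of $\Gamma$ with coefficients in the constant sequence $(E)_{k\in\mathbb{N}}$ with its constant $\Gamma$-action, that is $H^n_a(\Gamma;E)=\ker d^{n+1}_{\mathcal{U}}/\operatorname{im}d^n_{\mathcal{U}}$, where $d^n_{\mathcal{U}}:C^{n-1}_b(\Gamma;E)^{\mathcal{U}}\to C^n_b(\Gamma;E)^{\mathcal{U}}$ is induced by $d^n$. *)

theory Defs
  imports
    "HOL-Analysis.Analysis"
    "HOL-Algebra.Group_Action"
    "HOL-Library.Function_Algebras"
    "HOL-Library.Set_Algebras"
begin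

section \<open>Quotients\<close>

text \<open>
  The quotient of an additive group (or vector space) \<open>V\<close> by a subgroup \<open>N\<close> is the set of
  cosets \<open>x + N\<close>.  Cosets are added as sets (Minkowski sum), which for cosets of \<open>N\<close> is
  \<open>(x + N) + (y + N) = (x + y) + N\<close>; the zero element of the quotient is the coset \<open>N\<close>.
  Since the elements of a quotient are again added with \<open>+\<close>, the construction can be iterated,
  which is used below for quotients of subspaces of an ultrapower.
\<close>

definition quotient_space :: "'a::plus set \<Rightarrow> 'a set \<Rightarrow> 'a set set" where
  "quotient_space V N = (\<lambda>x. x +o N) ` V"

definition quotient_topology :: "'a topology \<Rightarrow> ('a \<Rightarrow> 'b) \<Rightarrow> 'b topology" where
  "quotient_topology X q =
     topology (\<lambda>W. W \<subseteq> q ` topspace X \<and> openin X {x \<in> topspace X. q x \<in> W})"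

lemma openin_quotient_topology:
  "openin (quotient_topology X q) W \<longleftrightarrow>
     W \<subseteq> q ` topspace X \<and> openin X {x \<in> topspace X. q x \<in> W}"
proof -
  have "istopology (\<lambda>W. W \<subseteq> q ` topspace X \<and> openin X {x \<in> topspace X. q x \<in> W})"
    unfolding istopology_def
  proof (intro conjI allI impI; (elim conjE)?)
    fix S T
    assume "openin X {x \<in> topspace X. q x \<in> S}" "openin X {x \<in> topspace X. q x \<in> T}"
    then have "openin X ({x \<in> topspace X. q x \<in> S} \<inter> {x \<in> topspace X. q x \<in> T})"
      by (rule openin_Int)
    then show "openin X {x \<in> topspace X. q x \<in> S \<inter> T}"
      by (rule back_subst[of "openin X"]) auto
  next
    fix \<K>
    assume "\<forall>K\<in>\<K>. K \<subseteq> q ` topspace X \<and> openin X {x \<in> topspace X. q x \<in> K}"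
    then have "openin X (\<Union>K\<in>\<K>. {x \<in> topspace X. q x \<in> K})"
      by (intro openin_Union) auto
    then show "openin X {x \<in> topspace X. q x \<in> \<Union>\<K>}"
      by (rule back_subst[of "openin X"]) auto
  qed auto
  then show ?thesis
    by (simp add: quotient_topology_def topology_inverse')
qed

lemma topspace_quotient_topology: "topspace (quotient_topology X q) = q ` topspace X"
proof -
  have "openin (quotient_topology X q) (q ` topspace X)"
    unfolding openin_quotient_topology
    by (auto intro: back_subst[of "openin X", OF openin_topspace])
  then show ?thesis
    by (metis openin_quotient_topology openin_subset openin_topspace subset_antisym)
qed

lemma quotient_map_quotient_topology: "quotient_map X (quotient_topology X q) q"
  by (auto simp: quotient_map_def openin_quotient_topology topspace_quotient_topology)


section \<open>Ultrapowers\<close>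

definition nonprincipal_ultrafilter :: "nat filter \<Rightarrow> bool" where
  "nonprincipal_ultrafilter U \<longleftrightarrow>
     U \<noteq> bot \<and>
     (\<forall>P. eventually P U \<or> eventually (\<lambda>k. \<not> P k) U) \<and>
     (\<forall>k. \<not> eventually (\<lambda>i. i = k) U)"

text \<open>
  In the following, \<open>V\<close> is the underlying set of a normed space with norm \<open>nrm\<close>,
  and its operations are the ones of the ambient type (pointwise for functions).
\<close>

definition bounded_seqs :: "'v set \<Rightarrow> ('v \<Rightarrow> real) \<Rightarrow> (nat \<Rightarrow> 'v) set" where
  "bounded_seqs V nrm = {x. (\<forall>k. x k \<in> V) \<and> (\<exists>B. \<forall>k. nrm (x k) \<le> B)}"

definition null_seqs :: "nat filter \<Rightarrow> 'v set \<Rightarrow> ('v \<Rightarrow> real) \<Rightarrow> (nat \<Rightarrow> 'v) set" where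
  "null_seqs U V nrm = {x \<in> bounded_seqs V nrm. ((\<lambda>k. nrm (x k)) \<longlongrightarrow> 0) U}"

definition ultrapower :: "nat filter \<Rightarrow> 'v::plus set \<Rightarrow> ('v \<Rightarrow> real) \<Rightarrow> (nat \<Rightarrow> 'v) set set" where
  "ultrapower U V nrm = quotient_space (bounded_seqs V nrm) (null_seqs U V nrm)"

text \<open>
  The map \<open>[x\<^sub>k] \<mapsto> [f x\<^sub>k]\<close> into the ultrapower of \<open>W\<close>.  For a bounded linear
  \<open>f\<close> from \<open>V\<close> to \<open>W\<close> the class of \<open>f \<circ> x\<close> is the same for all
  representatives \<open>x\<close> of \<open>X\<close>, so the union is a union of equal sets.
\<close>

definition ultrapower_map ::
  "nat filter \<Rightarrow> 'w::plus set \<Rightarrow> ('w \<Rightarrow> real) \<Rightarrow> ('v \<Rightarrow> 'w) \<Rightarrow> (nat \<Rightarrow> 'v) set \<Rightarrow> (nat \<Rightarrow> 'w) set"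
where
  "ultrapower_map U W nrm f X = (\<Union>x\<in>X. (f \<circ> x) +o null_seqs U W nrm)"


section \<open>Banach modules and bounded cochains\<close>

locale banach_module = group_action G "UNIV :: 'e set" act
  for G (structure) and act :: "'g \<Rightarrow> 'e::banach \<Rightarrow> 'e" +
  assumes linear_act: "g \<in> carrier G \<Longrightarrow> linear (act g)"
    and norm_act: "g \<in> carrier G \<Longrightarrow> norm (act g x) = norm x"

definition tuples :: "('g, 'm) monoid_scheme \<Rightarrow> nat \<Rightarrow> 'g list set" where
  "tuples G n = {xs. set xs \<subseteq> carrier G \<and> length xs = n}"

text \<open>
  Cochains of degree \<open>n\<close> are extended by \<open>0\<close> outside the \<open>n\<close>-tuples (rather than by
  \<^const>\<open>undefined\<close>), so that they are closed under pointwise addition and the supremum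
  over all lists is the supremum over \<open>n\<close>-tuples.
\<close>

definition cochains :: "('g, 'm) monoid_scheme \<Rightarrow> nat \<Rightarrow> ('g list \<Rightarrow> 'e::real_normed_vector) set" where
  "cochains G n =
     {f. bounded (f ` tuples G n) \<and> (\<forall>xs. xs \<notin> tuples G n \<longrightarrow> f xs = 0)}"

definition sup_norm :: "('a \<Rightarrow> 'e::real_normed_vector) \<Rightarrow> real" where
  "sup_norm f = (SUP x. norm (f x))"

text \<open>
  The case distinction only makes the distance total, as \<^locale>\<open>Metric_space\<close> requires.
\<close>

definition cochain_dist ::
  "('g, 'm) monoid_scheme \<Rightarrow> nat \<Rightarrow> ('g list \<Rightarrow> 'e::real_normed_vector) \<Rightarrow> ('g list \<Rightarrow> 'e) \<Rightarrow> real"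
where
  "cochain_dist G n f g =
     (if f \<in> cochains G n \<and> g \<in> cochains G n then sup_norm (\<lambda>xs. f xs - g xs) else 0)"

definition cochain_topology ::
  "('g, 'm) monoid_scheme \<Rightarrow> nat \<Rightarrow> ('g list \<Rightarrow> 'e::real_normed_vector) topology"
where
  "cochain_topology G n = Metric_space.mtopology (cochains G n) (cochain_dist G n)"

text \<open>
  Only meaningful for \<open>n \<ge> 1\<close>.  Lists are indexed from \<open>0\<close>, so \<open>\<gamma>\<^sub>i\<close> is \<open>xs ! (i - 1)\<close>.
\<close>

definition codifferential ::
  "('g, 'm) monoid_scheme \<Rightarrow> ('g \<Rightarrow> 'e \<Rightarrow> 'e) \<Rightarrow> nat \<Rightarrow>
     ('g list \<Rightarrow> 'e::real_normed_vector) \<Rightarrow> 'g list \<Rightarrow> 'e"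
where
  "codifferential G act n f xs =
     (if xs \<in> tuples G n then
        act (hd xs) (f (tl xs))
        + (\<Sum>i = 1..n - 1. (- 1) ^ i *\<^sub>R
             f (take (i - 1) xs @ [xs ! (i - 1) \<otimes>\<^bsub>G\<^esub> xs ! i] @ drop (i + 1) xs))
        + (- 1) ^ n *\<^sub>R f (butlast xs)
      else 0)"

lemma bdd_above_cochain:
  assumes "f \<in> cochains G n"
  shows "bdd_above (range (\<lambda>xs. norm (f xs)))"
proof -
  from assms obtain B where B: "\<And>xs. xs \<in> tuples G n \<Longrightarrow> norm (f xs) \<le> B"
    unfolding cochains_def bounded_iff by auto
  have "norm (f xs) \<le> max B 0" for xs
    using assms B[of xs] by (cases "xs \<in> tuples G n") (auto simp: cochains_def)
  then show ?thesis by (intro bdd_aboveI2)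
qed

lemma norm_le_sup_norm:
  assumes "f \<in> cochains G n"
  shows "norm (f xs) \<le> sup_norm f"
  unfolding sup_norm_def by (rule cSUP_upper[OF UNIV_I bdd_above_cochain[OF assms]])

lemma diff_cochain:
  assumes "f \<in> cochains G n" "g \<in> cochains G n"
  shows "(\<lambda>xs. f xs - g xs) \<in> cochains G n"
  using assms by (auto simp: cochains_def intro: bounded_minus_comp)

lemma Metric_space_cochains:
  "Metric_space (cochains G n :: ('g list \<Rightarrow> 'e::real_normed_vector) set) (cochain_dist G n)"
proof
  fix f g h :: "'g list \<Rightarrow> 'e"
  show "0 \<le> cochain_dist G n f g"
    by (auto simp: cochain_dist_def intro: order_trans[OF norm_ge_zero norm_le_sup_norm[OF diff_cochain]])
  show "cochain_dist G n f g = cochain_dist G n g f"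
    by (auto simp: cochain_dist_def sup_norm_def norm_minus_commute)
  assume f: "f \<in> cochains G n" and g: "g \<in> cochains G n"
  show "cochain_dist G n f g = 0 \<longleftrightarrow> f = g"
  proof
    assume "cochain_dist G n f g = 0"
    with f g have "norm (f xs - g xs) \<le> 0" for xs
      using norm_le_sup_norm[OF diff_cochain[OF f g]] by (simp add: cochain_dist_def)
    then show "f = g" by auto
  qed (simp add: cochain_dist_def sup_norm_def)
  assume h: "h \<in> cochains G n"
  have "norm (f xs - h xs) \<le> sup_norm (\<lambda>xs. f xs - g xs) + sup_norm (\<lambda>xs. g xs - h xs)" for xs
    using norm_triangle_ineq[of "f xs - g xs" "g xs - h xs"]
      norm_le_sup_norm[OF diff_cochain[OF f g], of xs]
      norm_le_sup_norm[OF diff_cochain[OF g h], of xs] by simp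
  then have "sup_norm (\<lambda>xs. f xs - h xs) \<le> sup_norm (\<lambda>xs. f xs - g xs) + sup_norm (\<lambda>xs. g xs - h xs)"
    unfolding sup_norm_def[of "\<lambda>xs. f xs - h xs"] by (intro cSUP_least) auto
  then show "cochain_dist G n f h \<le> cochain_dist G n f g + cochain_dist G n g h"
    using f g h by (simp add: cochain_dist_def)
qed

lemma (in banach_module) codifferential_in_cochains:
  assumes f: "f \<in> cochains G (n - 1)" and n: "n \<ge> 1"
  shows "codifferential G act n f \<in> cochains G n"
proof -
  let ?s = "\<lambda>xs i. (- 1) ^ i *\<^sub>R f (take (i - 1) xs @ [xs ! (i - 1) \<otimes> xs ! i] @ drop (i + 1) xs)"
  have "norm (codifferential G act n f xs) \<le> sup_norm f + (\<Sum>i = 1..n - 1. sup_norm f) + sup_norm f"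
    if xs: "xs \<in> tuples G n" for xs
  proof -
    have "hd xs \<in> carrier G"
      using xs n by (cases xs) (auto simp: tuples_def)
    moreover have "norm (\<Sum>i = 1..n - 1. ?s xs i) \<le> (\<Sum>i = 1..n - 1. sup_norm f)"
      by (rule sum_norm_le) (simp add: norm_le_sup_norm[OF f])
    ultimately have "norm (act (hd xs) (f (tl xs)) + sum (?s xs) {1..n - 1} + (- 1) ^ n *\<^sub>R f (butlast xs))
        \<le> sup_norm f + (\<Sum>i = 1..n - 1. sup_norm f) + sup_norm f"
      using norm_le_sup_norm[OF f]
      by (intro norm_triangle_mono) (auto simp: norm_act)
    then show ?thesis
      using xs by (simp add: codifferential_def)
  qed
  then have "bounded (codifferential G act n f ` tuples G n)"
    unfolding bounded_iff by blast
  then show ?thesis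
    by (auto simp: cochains_def codifferential_def)
qed


section \<open>Bounded cohomology\<close>

definition bounded_cocycles ::
  "('g, 'm) monoid_scheme \<Rightarrow> ('g \<Rightarrow> 'e \<Rightarrow> 'e) \<Rightarrow> nat \<Rightarrow> ('g list \<Rightarrow> 'e::banach) set"
where
  "bounded_cocycles G act n = {f \<in> cochains G n. codifferential G act (n + 1) f = 0}"

definition bounded_coboundaries ::
  "('g, 'm) monoid_scheme \<Rightarrow> ('g \<Rightarrow> 'e \<Rightarrow> 'e) \<Rightarrow> nat \<Rightarrow> ('g list \<Rightarrow> 'e::banach) set"
where
  "bounded_coboundaries G act n =
     (if n = 0 then {0} else codifferential G act n ` cochains G (n - 1))"

definition bounded_cohomology ::
  "('g, 'm) monoid_scheme \<Rightarrow> ('g \<Rightarrow> 'e \<Rightarrow> 'e) \<Rightarrow> nat \<Rightarrow> ('g list \<Rightarrow> 'e::banach) set set"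
where
  "bounded_cohomology G act n =
     quotient_space (bounded_cocycles G act n) (bounded_coboundaries G act n)"

definition bounded_cohomology_topology ::
  "('g, 'm) monoid_scheme \<Rightarrow> ('g \<Rightarrow> 'e \<Rightarrow> 'e) \<Rightarrow> nat \<Rightarrow> ('g list \<Rightarrow> 'e::banach) set topology"
where
  "bounded_cohomology_topology G act n =
     quotient_topology (subtopology (cochain_topology G n) (bounded_cocycles G act n))
       (\<lambda>f. f +o bounded_coboundaries G act n)"

lemma topspace_bounded_cohomology_topology:
  fixes act :: "'g \<Rightarrow> 'e::banach \<Rightarrow> 'e"
  shows "topspace (bounded_cohomology_topology G act n) = bounded_cohomology G act n"
proof -
  have "topspace (cochain_topology G n) = (cochains G n :: ('g list \<Rightarrow> 'e) set)"
    unfolding cochain_topology_def by (rule Metric_space.topspace_mtopology[OF Metric_space_cochains])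
  then have "cochains G n \<inter> bounded_cocycles G act n = bounded_cocycles G act n"
    "topspace (cochain_topology G n) = (cochains G n :: ('g list \<Rightarrow> 'e) set)"
    by (auto simp: bounded_cocycles_def)
  then show ?thesis
    by (simp add: bounded_cohomology_topology_def topspace_quotient_topology
        bounded_cohomology_def quotient_space_def)
qed


section \<open>Diagonal asymptotic cohomology\<close>

abbreviation ultra_cochains ::
  "('g, 'm) monoid_scheme \<Rightarrow> nat filter \<Rightarrow> nat \<Rightarrow> (nat \<Rightarrow> 'g list \<Rightarrow> 'e::banach) set set"
where
  "ultra_cochains G U n \<equiv> ultrapower U (cochains G n) sup_norm"

definition ultra_codifferential ::
  "('g, 'm) monoid_scheme \<Rightarrow> ('g \<Rightarrow> 'e \<Rightarrow> 'e) \<Rightarrow> nat filter \<Rightarrow> nat \<Rightarrow>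
     (nat \<Rightarrow> 'g list \<Rightarrow> 'e::banach) set \<Rightarrow> (nat \<Rightarrow> 'g list \<Rightarrow> 'e) set"
where
  "ultra_codifferential G act U n =
     ultrapower_map U (cochains G n) sup_norm (codifferential G act n)"

text \<open>\<^term>\<open>null_seqs U (cochains G n) sup_norm\<close> is the zero element of \<^term>\<open>ultra_cochains G U n\<close>.\<close>

definition asymptotic_cocycles ::
  "('g, 'm) monoid_scheme \<Rightarrow> ('g \<Rightarrow> 'e \<Rightarrow> 'e) \<Rightarrow> nat filter \<Rightarrow> nat \<Rightarrow>
     (nat \<Rightarrow> 'g list \<Rightarrow> 'e::banach) set set"
where
  "asymptotic_cocycles G act U n =
     {X \<in> ultra_cochains G U n.
        ultra_codifferential G act U (n + 1) X = null_seqs U (cochains G (n + 1)) sup_norm}"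

definition asymptotic_coboundaries ::
  "('g, 'm) monoid_scheme \<Rightarrow> ('g \<Rightarrow> 'e \<Rightarrow> 'e) \<Rightarrow> nat filter \<Rightarrow> nat \<Rightarrow>
     (nat \<Rightarrow> 'g list \<Rightarrow> 'e::banach) set set"
where
  "asymptotic_coboundaries G act U n =
     (if n = 0 then {null_seqs U (cochains G 0) sup_norm}
      else ultra_codifferential G act U n ` ultra_cochains G U (n - 1))"

definition asymptotic_cohomology ::
  "('g, 'm) monoid_scheme \<Rightarrow> ('g \<Rightarrow> 'e \<Rightarrow> 'e) \<Rightarrow> nat filter \<Rightarrow> nat \<Rightarrow>
     (nat \<Rightarrow> 'g list \<Rightarrow> 'e::banach) set set set"
where
  "asymptotic_cohomology G act U n =
     quotient_space (asymptotic_cocycles G act U n) (asymptotic_coboundaries G act U n)"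

text \<open>
  The zero element of a quotient by \<open>N\<close> is \<open>N\<close> itself, so a cohomology group vanishes iff it
  is the singleton consisting of the subspace of coboundaries.
\<close>

definition bounded_cohomology_vanishes ::
  "('g, 'm) monoid_scheme \<Rightarrow> ('g \<Rightarrow> 'e::banach \<Rightarrow> 'e) \<Rightarrow> nat \<Rightarrow> bool"
where
  "bounded_cohomology_vanishes G act n \<longleftrightarrow>
     bounded_cohomology G act n = {bounded_coboundaries G act n}"

definition asymptotic_cohomology_vanishes ::
  "('g, 'm) monoid_scheme \<Rightarrow> ('g \<Rightarrow> 'e::banach \<Rightarrow> 'e) \<Rightarrow> nat filter \<Rightarrow> nat \<Rightarrow> bool"
where
  "asymptotic_cohomology_vanishes G act U n \<longleftrightarrow>
     asymptotic_cohomology G act U n = {asymptotic_coboundaries G act U n}"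

end

theory Submission
  imports Defs "HOL-Probability.Discrete_Topology"
begin

text \<open>
  The theorem is a statement about bounded linear maps \<open>S : A \<rightarrow> B\<close> and \<open>T : B \<rightarrow> C\<close> of Banach spaces with
  \<open>T \<circ> S = 0\<close>: the ultrapower of the sequence is exact at \<open>B\<close> iff the sequence is exact at \<open>B\<close> and
  \<open>T\<close> has closed image.  If the latter holds, then by the open mapping theorem one can choose
  preimages under \<open>S\<close> and \<open>T\<close> of linearly bounded norm; a sequence with \<open>T x\<^sub>k \<rightarrow> 0\<close> can
  therefore be moved into \<open>ker T = im S\<close> by a null sequence and then lifted to a bounded sequence in
  \<open>A\<close>.  Conversely, exactness of the ultrapower yields by a diagonal argument an \<open>m\<close> such that each
  \<open>x\<close> in the unit ball with \<open>norm (T x) \<le> 1 / (m + 1)\<close> is at distance at most \<open>1 / 2\<close> from \<open>S a\<close> for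
  some \<open>a\<close> with \<open>norm a \<le> m\<close>.  Iterating this on \<open>ker T\<close> gives \<open>ker T = im S\<close>.  For \<open>x\<close> with
  \<open>T x \<noteq> 0\<close>, iterating it halves the norm of \<open>x\<close> without changing \<open>T x\<close>, until
  \<open>norm x \<le> (m + 1) * norm (T x)\<close>; such a bound on preimages makes the image of \<open>T\<close> closed.
\<close>

section \<open>Exact sequences of Banach spaces\<close>

text \<open>The remainders \<open>r j\<close> at least halve in each round, so the corrections
  \<open>g (r j)\<close> are dominated by a geometric series; their sum converges and stays in the
  closed subspace \<open>A\<close>. The set \<open>S\<close> is only required to absorb the
  remainders. This lets the same iteration serve for an image, for the closure of an image and for a
  kernel.\<close>

lemma successive_approximation:
  fixes T :: "'a::banach \<Rightarrow> 'b::real_normed_vector"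
  assumes T: "bounded_linear T" and A: "subspace A" "closed A" and K: "0 \<le> K"
    and approx: "\<And>y. y \<in> S \<Longrightarrow> \<exists>x\<in>A. norm x \<le> K * norm y \<and> y - T x \<in> S \<and> norm (y - T x) \<le> norm y / 2"
    and y: "y \<in> S"
  shows "\<exists>x\<in>A. T x = y \<and> norm x \<le> 2 * K * norm y"
proof -
  interpret T: bounded_linear T by (rule T)
  obtain g where g: "\<And>y. y \<in> S \<Longrightarrow> g y \<in> A \<and> norm (g y) \<le> K * norm y
      \<and> y - T (g y) \<in> S \<and> norm (y - T (g y)) \<le> norm y / 2"
    using approx by metis
  define r where "r j = ((\<lambda>z. z - T (g z)) ^^ j) y" for j
  have r_Suc: "r (Suc j) = r j - T (g (r j))" for j by (simp add: r_def)
  have r: "r j \<in> S \<and> norm (r j) \<le> norm y * (1/2) ^ j" for j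
  proof (induction j)
    case 0
    show ?case using y by (simp add: r_def)
  next
    case (Suc j)
    then show ?case using g[of "r j"] by (auto simp: r_Suc)
  qed
  have "norm (g (r j)) \<le> (K * norm y) * (1/2) ^ j" for j
  proof -
    have "norm (g (r j)) \<le> K * norm (r j)" using g r by blast
    also have "\<dots> \<le> K * (norm y * (1/2) ^ j)" using r K by (intro mult_left_mono) auto
    finally show ?thesis by (simp add: mult.assoc)
  qed
  note bound = this
  have geo: "summable (\<lambda>j. (K * norm y) * (1/2::real) ^ j)"
    by (intro summable_mult summable_geometric) simp
  have sn: "summable (\<lambda>j. norm (g (r j)))"
    by (rule summable_comparison_test'[OF geo, of 0]) (simp add: bound)
  then have s: "summable (\<lambda>j. g (r j))" by (rule summable_norm_cancel)
  let ?x = "\<Sum>j. g (r j)"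
  have "?x \<in> A"
  proof (rule closed_sequentially[OF A(2)])
    show "(\<lambda>m. \<Sum>j<m. g (r j)) \<longlonglongrightarrow> ?x" using s by (rule summable_LIMSEQ)
    show "(\<Sum>j<m. g (r j)) \<in> A" for m using g r by (intro subspace_sum[OF A(1)]) blast
  qed
  moreover have "T ?x = y"
  proof (rule LIMSEQ_unique)
    show "(\<lambda>m. T (\<Sum>j<m. g (r j))) \<longlonglongrightarrow> T ?x"
      by (intro T.tendsto summable_LIMSEQ s)
    \<comment> \<open>The sum telescopes, because \<open>T (g (r j))\<close> is the difference of
      consecutive remainders.\<close>
    have "T (\<Sum>j<m. g (r j)) = y - r m" for m
      by (induction m) (auto simp: T.zero T.add r_Suc, simp add: r_def)
    moreover have "r \<longlonglongrightarrow> 0"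
    proof (rule Lim_null_comparison)
      show "(\<lambda>j. norm y * (1/2) ^ j) \<longlonglongrightarrow> 0"
        by (intro tendsto_mult_right_zero LIMSEQ_power_zero) simp
    qed (use r in auto)
    then have "(\<lambda>m. y - r m) \<longlonglongrightarrow> y - 0" by (intro tendsto_intros)
    ultimately show "(\<lambda>m. T (\<Sum>j<m. g (r j))) \<longlonglongrightarrow> y" by simp
  qed
  moreover have "norm ?x \<le> 2 * K * norm y"
  proof -
    have "norm ?x \<le> (\<Sum>j. norm (g (r j)))" by (rule summable_norm[OF sn])
    also have "\<dots> \<le> (\<Sum>j. (K * norm y) * (1/2) ^ j)" by (rule suminf_le[OF bound sn geo])
    also have "\<dots> = 2 * K * norm y"
      by (subst suminf_mult) (auto simp: suminf_geometric summable_geometric)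
    finally show ?thesis .
  qed
  ultimately show ?thesis by blast
qed

text \<open>This is the open mapping theorem for the restriction of \<open>T\<close> to
  \<open>A\<close>, in quantitative form. The image is complete because it is closed, so by Baire
  the closure of the image of some ball has interior points. Differences carry such a point to the
  origin, and \<open>successive_approximation\<close> turns approximate preimages into exact
  ones.\<close>

lemma open_mapping_bound:
  fixes T :: "'a::banach \<Rightarrow> 'b::banach"
  assumes T: "bounded_linear T" and A: "subspace A" "closed A" and cl: "closed (T ` A)"
  shows "\<exists>K\<ge>0. \<forall>y\<in>T ` A. \<exists>x\<in>A. T x = y \<and> norm x \<le> K * norm y"
proof -
  interpret T: bounded_linear T by (rule T)
  let ?S = "T ` A" and ?X = "top_of_set (T ` A)"
  let ?C = "\<lambda>k::nat. closure (T ` (A \<inter> cball 0 (real k)))"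
  have subS: "subspace ?S" by (intro linear_subspace_image T.linear A)
  have C: "?C k \<subseteq> ?S" for k by (intro closure_minimal cl image_mono) auto
  have un: "\<Union> (range ?C) = ?S"
  proof (intro subset_antisym UN_least C subsetI)
    fix y assume "y \<in> ?S"
    then obtain x where x: "x \<in> A" "y = T x" by auto
    obtain k::nat where "norm x \<le> k" using real_arch_simple by blast
    with x have "y \<in> T ` (A \<inter> cball 0 (real k))" by auto
    then have "y \<in> ?C k" by (rule subsetD[OF closure_subset])
    then show "y \<in> \<Union> (range ?C)" by (rule UN_I[OF UNIV_I])
  qed
  have "\<exists>k. ?X interior_of (?C k) \<noteq> {}"
  proof (rule ccontr)
    assume "\<nexists>k. ?X interior_of (?C k) \<noteq> {}"
    moreover have "completely_metrizable_space ?X"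
      by (intro completely_metrizable_space_closedin completely_metrizable_space_euclidean) (simp add: cl)
    moreover have "closedin ?X (?C k)" for k by (intro closed_subset C closed_closure)
    ultimately have "?X interior_of \<Union> (range ?C) = {}"
      by (intro Baire_category_alt) auto
    then have "?S = {}" unfolding un using interior_of_topspace[of ?X] by simp
    then show False using subspace_0[OF subS] by blast
  qed
  then obtain k y0 where "y0 \<in> ?X interior_of (?C k)" by blast
  then obtain W where W: "openin ?X W" "y0 \<in> W" "W \<subseteq> ?C k" by (auto simp: interior_of_def)
  then obtain e where e: "e > 0" "ball y0 e \<inter> ?S \<subseteq> W"
    by (auto simp: openin_contains_ball)
  have y0: "y0 \<in> ?S" using W C by blast
  \<comment> \<open>Both \<open>y0\<close> and \<open>y0 + y\<close> lie in \<open>?C k\<close>, so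
    \<open>y\<close> is approximated by the image of a difference of two vectors of norm at most
    \<open>k\<close>; hence the factor 2. The accuracy \<open>d\<close> is arbitrary and does not
    affect the bound on \<open>x\<close>.\<close>
  have near: "\<exists>x\<in>A. norm x \<le> 2 * real k \<and> norm (y - T x) < d" if y: "y \<in> ?S" "norm y < e" and d: "d > 0" for y d
  proof -
    have close: "\<exists>a. a \<in> A \<and> norm a \<le> k \<and> dist (T a) z < d/2" if z: "z \<in> ?C k" for z
    proof -
      obtain v where "v \<in> T ` (A \<inter> cball 0 (real k))" "dist v z < d/2"
        using z[unfolded closure_approachable, rule_format, OF half_gt_zero[OF d]] by blast
      then show ?thesis by auto
    qed
    obtain a where a: "a \<in> A" "norm a \<le> k" "dist (T a) y0 < d/2"
      using close[of y0] W by blast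
    have "y0 + y \<in> ?C k"
      using y e W y0 by (auto intro!: subsetD[OF W(3)] subsetD[OF e(2)] subspace_add[OF subS] simp: dist_norm)
    then obtain b where "b \<in> A" "norm b \<le> k" "dist (T b) (y0 + y) < d/2"
      using close by blast
    note ab = a this
    have "y - T (b - a) = (T a - y0) - (T b - (y0 + y))" by (simp add: T.diff)
    then have "norm (y - T (b - a)) < d"
      using ab(3,6) norm_triangle_ineq4[of "T a - y0" "T b - (y0 + y)"] unfolding dist_norm
      by (metis field_sum_of_halves add_strict_mono order_le_less_trans)
    moreover have "norm (b - a) \<le> 2 * real k" using ab norm_triangle_ineq4[of b a] by simp
    ultimately show ?thesis using ab subspace_diff[OF A(1)] by blast
  qed
  let ?K = "4 * real k / e"
  have approx: "\<exists>x\<in>A. norm x \<le> ?K * norm y \<and> y - T x \<in> ?S \<and> norm (y - T x) \<le> norm y / 2"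
    if y: "y \<in> ?S" for y
  proof (cases "y = 0")
    case True
    then show ?thesis using subspace_0[OF A(1)] subspace_0[OF subS] by (intro bexI[of _ 0]) (auto simp: T.zero)
  next
    case False
    \<comment> \<open>Scaling by \<open>c\<close> brings \<open>y\<close> to norm
      \<open>e / 2\<close>, inside the ball where \<open>near\<close> applies. Undoing it turns the
      bound \<open>2 * real k\<close> into \<open>?K * norm y\<close>.\<close>
    define c where "c = e / (2 * norm y)"
    have c: "c > 0" using False e by (simp add: c_def)
    have "c *\<^sub>R y \<in> ?S" using y subspace_scale[OF subS] by blast
    moreover have "norm (c *\<^sub>R y) < e" using False e by (simp add: c_def)
    moreover have "c * (norm y / 2) > 0" using c False by simp
    ultimately obtain x where x: "x \<in> A" "norm x \<le> 2 * real k" "norm (c *\<^sub>R y - T x) < c * (norm y / 2)"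
      using near by blast
    let ?x = "(1/c) *\<^sub>R x"
    have "?x \<in> A" using x subspace_scale[OF A(1)] by blast
    moreover have "norm ?x \<le> ?K * norm y"
      using x c False e by (simp add: c_def field_simps)
    moreover have "norm (y - T ?x) \<le> norm y / 2"
    proof -
      have "c *\<^sub>R (y - T ?x) = c *\<^sub>R y - T x" using c by (simp add: T.scaleR scaleR_diff_right)
      then have "c * norm (y - T ?x) < c * (norm y / 2)" using x c by (metis abs_of_pos norm_scaleR)
      then show ?thesis using c by simp
    qed
    ultimately show ?thesis using y subspace_diff[OF subS] by blast
  qed
  have "\<exists>x\<in>A. T x = y \<and> norm x \<le> 2 * ?K * norm y" if "y \<in> ?S" for y
    by (rule successive_approximation[OF T A _ approx that]) (use e in auto)
  then show ?thesis using e by (intro exI[of _ "2 * ?K"]) auto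
qed

lemma subspace_closure:
  fixes S :: "'a::real_normed_vector set"
  assumes "subspace S"
  shows "subspace (closure S)"
proof (rule subspaceI)
  show "0 \<in> closure S" using subspace_0[OF assms] closure_subset by blast
next
  fix x y assume "x \<in> closure S" "y \<in> closure S"
  then obtain a b where "\<And>n. a n \<in> S" "a \<longlonglongrightarrow> x" "\<And>n. b n \<in> S" "b \<longlonglongrightarrow> y"
    unfolding closure_sequential by blast
  then show "x + y \<in> closure S"
    unfolding closure_sequential using subspace_add[OF assms] tendsto_add
    by (intro exI[of _ "\<lambda>n. a n + b n"]) blast
next
  fix c x assume "x \<in> closure S"
  then obtain a where "\<And>n. a n \<in> S" "a \<longlonglongrightarrow> x"
    unfolding closure_sequential by blast
  then show "c *\<^sub>R x \<in> closure S"
    unfolding closure_sequential using subspace_scale[OF assms] tendsto_scaleR[OF tendsto_const]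
    by (intro exI[of _ "\<lambda>n. c *\<^sub>R a n"]) blast
qed

text \<open>A point of the closure is approximated up to half its norm by an image point of at most
  twice its norm, which has a controlled preimage. Iterating within the closure yields an exact
  preimage.\<close>

lemma closed_image_if_bound:
  fixes T :: "'a::banach \<Rightarrow> 'b::real_normed_vector"
  assumes T: "bounded_linear T" and A: "subspace A" "closed A" and K: "0 \<le> K"
    and lift: "\<And>y. y \<in> T ` A \<Longrightarrow> \<exists>x\<in>A. T x = y \<and> norm x \<le> K * norm y"
  shows "closed (T ` A)"
proof -
  interpret T: bounded_linear T by (rule T)
  let ?S = "closure (T ` A)"
  have subS: "subspace ?S"
    by (intro subspace_closure linear_subspace_image T.linear A)
  have approx: "\<exists>x\<in>A. norm x \<le> (2 * K) * norm y \<and> y - T x \<in> ?S \<and> norm (y - T x) \<le> norm y / 2"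
    if y: "y \<in> ?S" for y
  proof (cases "y = 0")
    case True
    then show ?thesis using subspace_0[OF A(1)] subspace_0[OF subS] by (intro bexI[of _ 0]) (auto simp: T.zero)
  next
    case False
    then obtain z where z: "z \<in> T ` A" "dist z y < norm y / 2"
      using y unfolding closure_approachable by (metis half_gt_zero zero_less_norm_iff)
    then obtain x where x: "x \<in> A" "T x = z" "norm x \<le> K * norm z" using lift by blast
    have "norm z \<le> 2 * norm y" using z(2) norm_triangle_sub[of z y] norm_ge_zero[of y] unfolding dist_norm by linarith
    then have "norm x \<le> K * (2 * norm y)" using x(3) K by (meson mult_left_mono order_trans)
    moreover have "y - T x \<in> ?S"
      using subspace_diff[OF subS y] x z closure_subset by blast
    ultimately show ?thesis using x z by (intro bexI[of _ x]) (auto simp: dist_norm norm_minus_commute)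
  qed
  have "?S \<subseteq> T ` A"
  proof
    fix y assume "y \<in> ?S"
    from successive_approximation[OF T A _ approx this] K show "y \<in> T ` A" by auto
  qed
  then show ?thesis by (metis closure_subset closed_closure subset_antisym)
qed

text \<open>
  For subspaces \<open>A\<close>, \<open>B\<close> and maps \<open>S\<close> on \<open>A\<close>, \<open>T\<close> on \<open>B\<close>, this is exactness in the middle of
  \<open>A\<^sup>U \<rightarrow> B\<^sup>U \<rightarrow> C\<^sup>U\<close> (more precisely: kernel contained in image), expressed by representatives.
\<close>

definition ultra_exact ::
  "nat filter \<Rightarrow> ('a::real_normed_vector \<Rightarrow> 'b::real_normed_vector) \<Rightarrow> ('b \<Rightarrow> 'c::real_normed_vector)
    \<Rightarrow> 'a set \<Rightarrow> 'b set \<Rightarrow> bool" where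
  "ultra_exact U S T A B \<longleftrightarrow>
    (\<forall>x. (\<forall>k. x k \<in> B) \<longrightarrow> bounded (range x) \<longrightarrow> ((\<lambda>k. T (x k)) \<longlongrightarrow> 0) U \<longrightarrow>
      (\<exists>a. (\<forall>k. a k \<in> A) \<and> bounded (range a) \<and> ((\<lambda>k. x k - S (a k)) \<longlongrightarrow> 0) U))"

section \<open>Exactness of the ultrapower versus exactness with closed image\<close>

lemma ultra_exact_if_exact:
  fixes S :: "'a::banach \<Rightarrow> 'b::banach" and T :: "'b \<Rightarrow> 'c::banach"
  assumes S: "bounded_linear S" and T: "bounded_linear T"
    and A: "subspace A" "closed A" and B: "subspace B" "closed B"
    and SA: "S ` A = {b \<in> B. T b = 0}" and cl: "closed (T ` B)"
  shows "ultra_exact U S T A B"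
  unfolding ultra_exact_def
proof (intro allI impI)
  interpret S: bounded_linear S by (rule S)
  interpret T: bounded_linear T by (rule T)
  fix x :: "nat \<Rightarrow> 'b"
  assume x: "\<forall>k. x k \<in> B" "bounded (range x)" and Tx: "((\<lambda>k. T (x k)) \<longlongrightarrow> 0) U"
  \<comment> \<open>By exactness this kernel is the image of \<open>S\<close>, so the open mapping
    bound is available for \<open>S\<close> as well as for \<open>T\<close>.\<close>
  have "closed {b \<in> B. T b = 0}"
    using closed_Int[OF B(2) closed_Collect_eq[OF T.continuous_on[OF continuous_on_id] continuous_on_const, of 0]]
    by (simp add: Collect_conj_eq)
  then obtain K where K: "K \<ge> 0" "\<And>y. y \<in> S ` A \<Longrightarrow> \<exists>a\<in>A. S a = y \<and> norm a \<le> K * norm y"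
    using open_mapping_bound[OF S A] SA by metis
  obtain L where L: "L \<ge> 0" "\<And>y. y \<in> T ` B \<Longrightarrow> \<exists>b\<in>B. T b = y \<and> norm b \<le> L * norm y"
    using open_mapping_bound[OF T B cl] by metis
  have "\<exists>b\<in>B. T b = T (x k) \<and> norm b \<le> L * norm (T (x k))" for k
    using L(2) x(1) by blast
  then obtain b where b: "\<And>k. b k \<in> B" "\<And>k. T (b k) = T (x k)" "\<And>k. norm (b k) \<le> L * norm (T (x k))"
    by metis
  have "x k - b k \<in> S ` A" for k
    using x b subspace_diff[OF B(1)] by (simp add: SA T.diff)
  then have "\<exists>a\<in>A. S a = x k - b k \<and> norm a \<le> K * norm (x k - b k)" for k
    using K(2) by blast
  then obtain a where a: "\<And>k. a k \<in> A" "\<And>k. S (a k) = x k - b k" "\<And>k. norm (a k) \<le> K * norm (x k - b k)"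
    by metis
  obtain M where M: "\<And>k. norm (x k) \<le> M" using x(2) by (auto simp: bounded_iff)
  obtain N where N: "N \<ge> 0" "\<And>z. norm (T z) \<le> norm z * N" using T.nonneg_bounded by blast
  have "norm (a k) \<le> K * (M + L * (M * N))" for k
  proof -
    have "norm (T (x k)) \<le> M * N" using N(2)[of "x k"] M[of k] N(1) by (meson mult_right_mono order_trans)
    then have "norm (b k) \<le> L * (M * N)" using b(3)[of k] L(1) by (meson mult_left_mono order_trans)
    then have "norm (x k - b k) \<le> M + L * (M * N)" using norm_triangle_ineq4[of "x k" "b k"] M[of k] by simp
    then show ?thesis using a(3)[of k] K(1) by (meson mult_left_mono order_trans)
  qed
  then have "bounded (range a)" by (auto simp: bounded_iff)
  \<comment> \<open>The difference is exactly \<open>b k\<close>, the small preimage of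
    \<open>T (x k)\<close>.\<close>
  moreover have "((\<lambda>k. x k - S (a k)) \<longlongrightarrow> 0) U"
  proof (rule Lim_null_comparison)
    show "((\<lambda>k. L * norm (T (x k))) \<longlongrightarrow> 0) U"
      by (intro tendsto_mult_right_zero tendsto_norm_zero Tx)
    show "\<forall>\<^sub>F k in U. norm (x k - S (a k)) \<le> L * norm (T (x k))" by (simp add: a(2) b(3))
  qed
  ultimately show "\<exists>a. (\<forall>k. a k \<in> A) \<and> bounded (range a) \<and> ((\<lambda>k. x k - S (a k)) \<longlongrightarrow> 0) U"
    using a(1) by blast
qed

lemma exact_if_ultra_exact:
  fixes S :: "'a::banach \<Rightarrow> 'b::banach" and T :: "'b \<Rightarrow> 'c::banach"
  assumes S: "bounded_linear S" and T: "bounded_linear T"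
    and A: "subspace A" "closed A" and B: "subspace B" "closed B"
    and SA: "S ` A \<subseteq> {b \<in> B. T b = 0}" and U: "U \<noteq> bot" "U \<le> sequentially"
    and ex: "ultra_exact U S T A B"
  shows "S ` A = {b \<in> B. T b = 0}" and "closed (T ` B)"
proof -
  interpret S: bounded_linear S by (rule S)
  interpret T: bounded_linear T by (rule T)
  \<comment> \<open>The diagonal argument: counterexamples for all \<open>m\<close>, taken as one
    sequence, form a bounded sequence whose images tend to 0. A single \<open>m\<close> serves both
    as the bound on \<open>a\<close> and, through \<open>Suc m\<close>, as the smallness required of
    \<open>T x\<close>.\<close>
  have "\<exists>m::nat. \<forall>x\<in>B. norm x \<le> 1 \<and> norm (T x) \<le> inverse (real (Suc m)) \<longrightarrow>
          (\<exists>a\<in>A. norm a \<le> real m \<and> norm (x - S a) \<le> 1/2)"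
  proof (rule ccontr)
    assume "\<not> ?thesis"
    then obtain x where x: "\<And>m. x m \<in> B" "\<And>m. norm (x m) \<le> 1"
        "\<And>m. norm (T (x m)) \<le> inverse (real (Suc m))"
        "\<And>m a. a \<in> A \<Longrightarrow> norm a \<le> real m \<Longrightarrow> \<not> norm (x m - S a) \<le> 1/2"
      by metis
    have "((\<lambda>k. T (x k)) \<longlongrightarrow> 0) U"
      by (rule Lim_null_comparison[OF _ tendsto_mono[OF U(2) LIMSEQ_inverse_real_of_nat]])
        (use x(3) in simp)
    moreover have "bounded (range x)" using x(2) by (auto simp: bounded_iff)
    ultimately obtain a where a: "\<And>k. a k \<in> A" "bounded (range a)" "((\<lambda>k. x k - S (a k)) \<longlongrightarrow> 0) U"
      using ex x(1) unfolding ultra_exact_def by metis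
    obtain M where M: "\<And>k. norm (a k) \<le> M" using a(2) by (auto simp: bounded_iff)
    have "\<forall>\<^sub>F k in sequentially. M \<le> real k"
      using filterlim_real_sequentially by (simp add: filterlim_at_top)
    then have "\<forall>\<^sub>F k in U. M \<le> real k" using U(2) by (rule filter_leD[rotated])
    moreover have "\<forall>\<^sub>F k in U. norm (x k - S (a k)) < 1/2"
      using tendstoD[OF a(3), of "1/2"] by simp
    \<comment> \<open>Once \<open>k\<close> exceeds the bound \<open>M\<close> of the lifts,
      \<open>a k\<close> is one of the approximations that the choice of \<open>x k\<close> rules
      out.\<close>
    ultimately have "\<forall>\<^sub>F k in U. False"
    proof eventually_elim
      case (elim k)
      then have "norm (a k) \<le> real k" using M[of k] by linarith
      then show ?case using x(4)[OF a(1)] elim(2) by force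
    qed
    then show False using U(1) by simp
  qed
  then obtain m :: nat where m: "\<And>x. x \<in> B \<Longrightarrow> norm x \<le> 1 \<Longrightarrow> norm (T x) \<le> inverse (real (Suc m))
      \<Longrightarrow> \<exists>a\<in>A. norm a \<le> real m \<and> norm (x - S a) \<le> 1/2"
    by blast
  \<comment> \<open>Homogeneous form of \<open>m\<close>, by normalising \<open>x\<close>. Its
    second premise holds automatically on the kernel of \<open>T\<close>.\<close>
  have step: "\<exists>a\<in>A. norm a \<le> real m * norm x \<and> norm (x - S a) \<le> norm x / 2"
    if x: "x \<in> B" "real (Suc m) * norm (T x) \<le> norm x" for x
  proof (cases "x = 0")
    case True
    then show ?thesis using subspace_0[OF A(1)] by (intro bexI[of _ 0]) (auto simp: S.zero)
  next
    case False
    let ?c = "norm x"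
    have c: "?c > 0" using False by simp
    have "(1/?c) *\<^sub>R x \<in> B" using x subspace_scale[OF B(1)] by blast
    moreover have "norm ((1/?c) *\<^sub>R x) \<le> 1" by simp
    moreover have "norm (T ((1/?c) *\<^sub>R x)) \<le> inverse (real (Suc m))"
      using x(2) c by (simp add: T.scaleR field_simps)
    ultimately obtain a where a: "a \<in> A" "norm a \<le> real m" "norm ((1/?c) *\<^sub>R x - S a) \<le> 1/2"
      using m by blast
    have "x - S (?c *\<^sub>R a) = ?c *\<^sub>R ((1/?c) *\<^sub>R x - S a)"
      using c by (simp add: S.scaleR scaleR_diff_right)
    then have "norm (x - S (?c *\<^sub>R a)) = ?c * norm ((1/?c) *\<^sub>R x - S a)" by simp
    also have "\<dots> \<le> ?c * (1/2)" using a(3) by (intro mult_left_mono) auto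
    finally have "norm (x - S (?c *\<^sub>R a)) \<le> norm x / 2" by simp
    moreover have "norm (?c *\<^sub>R a) \<le> real m * norm x" using a(2) c by (simp add: mult.commute)
    ultimately show ?thesis using a(1) subspace_scale[OF A(1)] by blast
  qed
  have "{b \<in> B. T b = 0} \<subseteq> S ` A"
  proof
    fix x assume x: "x \<in> {b \<in> B. T b = 0}"
    \<comment> \<open>The remainder stays in the kernel because \<open>S\<close> maps
      \<open>A\<close> into it, so the step can be repeated.\<close>
    have "\<exists>a\<in>A. norm a \<le> real m * norm x \<and> x - S a \<in> {b \<in> B. T b = 0} \<and> norm (x - S a) \<le> norm x / 2"
      if x: "x \<in> {b \<in> B. T b = 0}" for x
    proof -
      obtain a where a: "a \<in> A" "norm a \<le> real m * norm x" "norm (x - S a) \<le> norm x / 2"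
        using x step[of x] by auto
      moreover have "S a \<in> {b \<in> B. T b = 0}" using SA a(1) by blast
      ultimately show ?thesis using x subspace_diff[OF B(1)] by (auto simp: T.diff)
    qed
    from successive_approximation[OF S A _ this x] show "x \<in> S ` A" by auto
  qed
  then show "S ` A = {b \<in> B. T b = 0}" using SA by blast
  have "\<exists>b\<in>B. T b = T x \<and> norm b \<le> real (Suc m) * norm (T x)" if x: "x \<in> B" for x
  proof (cases "T x = 0")
    case True
    then show ?thesis using subspace_0[OF B(1)] by (intro bexI[of _ 0]) (auto simp: T.zero)
  next
    case False
    show ?thesis
    proof (rule ccontr)
      assume no: "\<not> ?thesis"
      \<comment> \<open>By \<open>no\<close>, every preimage of \<open>T x\<close> in
        \<open>B\<close> is large enough for \<open>step\<close>, which halves its norm without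
        changing its image. Unlimited halving contradicts \<open>no\<close> itself, as
        \<open>T x\<close> is nonzero.\<close>
      have "\<exists>b\<in>B. T b = T x \<and> norm b \<le> norm x * (1/2) ^ j" for j
      proof (induction j)
        case 0
        show ?case using x by auto
      next
        case (Suc j)
        then obtain b where b: "b \<in> B" "T b = T x" "norm b \<le> norm x * (1/2) ^ j" by blast
        have "real (Suc m) * norm (T b) \<le> norm b"
          using no b(1,2) by (metis linear)
        then obtain a where a: "a \<in> A" "norm (b - S a) \<le> norm b / 2" using step b(1) by blast
        have "S a \<in> {b \<in> B. T b = 0}" using SA a(1) by blast
        then show ?case using a b subspace_diff[OF B(1)] by (intro bexI[of _ "b - S a"]) (auto simp: T.diff)
      qed
      moreover have "(\<lambda>j. norm x * (1/2) ^ j) \<longlonglongrightarrow> 0"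
        by (intro tendsto_mult_right_zero LIMSEQ_power_zero) simp
      then have "\<forall>\<^sub>F j in sequentially. norm x * (1/2) ^ j < real (Suc m) * norm (T x)"
        using False by (intro order_tendstoD) auto
      then obtain j where "norm x * (1/2) ^ j < real (Suc m) * norm (T x)"
        by (auto simp: eventually_sequentially)
      ultimately show False using no by (meson less_imp_le order_trans)
    qed
  qed
  then show "closed (T ` B)"
    by (intro closed_image_if_bound[OF T B, of "real (Suc m)"]) auto
qed

section \<open>Quotients of groups of sequences and of metric groups\<close>

definition add_subgroup :: "'a::ab_group_add set \<Rightarrow> bool" where
  "add_subgroup N \<longleftrightarrow> 0 \<in> N \<and> (\<forall>x\<in>N. \<forall>y\<in>N. x - y \<in> N)"

lemma add_subgroup_0: "add_subgroup N \<Longrightarrow> 0 \<in> N"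
  and add_subgroup_diff: "add_subgroup N \<Longrightarrow> x \<in> N \<Longrightarrow> y \<in> N \<Longrightarrow> x - y \<in> N"
  by (auto simp: add_subgroup_def)

lemma add_subgroup_uminus: "add_subgroup N \<Longrightarrow> x \<in> N \<Longrightarrow> - x \<in> N"
  using add_subgroup_diff[of N 0 x] by (simp add: add_subgroup_0)

lemma add_subgroup_add: "add_subgroup N \<Longrightarrow> x \<in> N \<Longrightarrow> y \<in> N \<Longrightarrow> x + y \<in> N"
  using add_subgroup_diff[of N x "- y"] by (simp add: add_subgroup_uminus)

lemma coset_eq_iff:
  assumes "add_subgroup N"
  shows "x +o N = y +o N \<longleftrightarrow> x - y \<in> N"
proof
  assume "x +o N = y +o N"
  moreover have "x + 0 \<in> x +o N" using add_subgroup_0[OF assms] by (rule set_plus_intro2)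
  ultimately show "x - y \<in> N" by (simp add: set_minus_plus)
next
  have sub: "u +o N \<subseteq> v +o N" if "u - v \<in> N" for u v
  proof
    fix z assume "z \<in> u +o N"
    then have "z - u \<in> N" by (simp add: set_minus_plus)
    from add_subgroup_add[OF assms this that] show "z \<in> v +o N" by (simp add: set_minus_plus[symmetric])
  qed
  assume "x - y \<in> N"
  moreover from add_subgroup_uminus[OF assms this] have "y - x \<in> N" by simp
  ultimately show "x +o N = y +o N" by (intro subset_antisym sub)
qed

lemma coset_eq_self_iff: "add_subgroup N \<Longrightarrow> x +o N = N \<longleftrightarrow> x \<in> N"
  using coset_eq_iff[of N x 0] by simp

lemma coset_plus_coset:
  assumes "add_subgroup N"
  shows "(x +o N) + (y +o N) = (x + y) +o N"
proof -
  have "N + N = N"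
    using add_subgroup_add[OF assms] set_zero_plus2[OF add_subgroup_0[OF assms]] by (auto elim!: set_plus_elim)
  then show ?thesis by (simp add: set_plus_rearrange)
qed

text \<open>Stated for semigroups with an explicit neutral element \<open>e\<close> of
  \<open>V\<close>, so that it also covers quotients whose elements are themselves cosets added as
  sets. There the neutral element is the inner subgroup, and inverses exist only relative to
  it.\<close>

lemma quotient_space_eq_singleton_iff:
  fixes V N :: "'a::ab_semigroup_add set"
  assumes "e \<in> N" "N \<subseteq> V" "\<And>x. x \<in> V \<Longrightarrow> x + e = x"
    and "\<And>x y. x \<in> N \<Longrightarrow> y \<in> N \<Longrightarrow> x + y \<in> N" and "\<And>x. x \<in> N \<Longrightarrow> \<exists>y\<in>N. x + y = e"
  shows "quotient_space V N = {N} \<longleftrightarrow> V \<subseteq> N"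
proof
  assume eq: "quotient_space V N = {N}"
  show "V \<subseteq> N"
  proof
    fix x assume x: "x \<in> V"
    then have "x +o N = N" using eq by (auto simp: quotient_space_def)
    moreover have "x + e \<in> x +o N" using assms(1) by (rule set_plus_intro2)
    ultimately show "x \<in> N" using assms(3) x by simp
  qed
next
  assume "V \<subseteq> N"
  then have V: "V = N" using assms(2) by blast
  have "x +o N = N" if x: "x \<in> N" for x
  proof (intro subset_antisym subsetI)
    fix z assume z: "z \<in> N"
    obtain y where y: "y \<in> N" "x + y = e" using assms(5) x by blast
    have "x + (y + z) = z + e" by (metis add.assoc add.commute y(2))
    also have "\<dots> = z" using assms(3) z V by simp
    finally show "z \<in> x +o N" using assms(4)[OF y(1) z] by (metis set_plus_intro2)
  qed (use assms(4) x in \<open>auto simp: elt_set_plus_def\<close>)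
  then show "quotient_space V N = {N}" using assms(1) by (auto simp: quotient_space_def V)
qed

text \<open>The right-hand side says that \<open>B\<close> is closed in \<open>Z\<close>. In a
  Hausdorff quotient the zero coset is a closed point, and its preimage is \<open>B\<close>.
  Conversely, if \<open>B\<close> is closed, distinct cosets have positive distance, and the images
  of small balls separate them.\<close>

lemma Hausdorff_space_quotient_iff:
  fixes Z B :: "'a::ab_group_add set"
  assumes "Metric_space M d" and Z: "Z \<subseteq> M" "add_subgroup Z" and B: "B \<subseteq> Z" "add_subgroup B"
    and inv: "\<And>x y z. x \<in> Z \<Longrightarrow> y \<in> Z \<Longrightarrow> z \<in> Z \<Longrightarrow> d (x - z) (y - z) = d x y"
  shows "Hausdorff_space (quotient_topology (subtopology (Metric_space.mtopology M d) Z) (\<lambda>x. x +o B)) \<longleftrightarrow>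
    (\<forall>x\<in>Z. (\<forall>e>0. \<exists>b\<in>B. d x b < e) \<longrightarrow> x \<in> B)"
proof -
  interpret Metric_space M d by fact
  let ?X = "subtopology mtopology Z" and ?q = "\<lambda>x. x +o B"
  let ?Y = "quotient_topology ?X ?q"
  have tX: "topspace ?X = Z" using Z by auto
  have BM: "B \<subseteq> M" using B Z by blast
  show ?thesis
  proof (intro iffI ballI impI)
    fix x
    assume H: "Hausdorff_space ?Y" and x: "x \<in> Z" and near: "\<forall>e>0. \<exists>b\<in>B. d x b < e"
    have "?q 0 \<in> topspace ?Y"
      unfolding topspace_quotient_topology tX using add_subgroup_0[OF Z(2)] by (rule imageI)
    then have "closedin ?Y {?q 0}" by (rule closedin_Hausdorff_singleton[OF H])
    then have "closedin ?X {x \<in> topspace ?X. ?q x \<in> {?q 0}}"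
      using quotient_map_quotient_topology[of ?X ?q] quotient_imp_continuous_map closedin_continuous_map_preimage
      by blast
    moreover have "{x \<in> topspace ?X. ?q x \<in> {?q 0}} = B"
      unfolding tX using B(1) coset_eq_iff[OF B(2), of _ 0] by auto
    ultimately have "closedin ?X B" by simp
    then obtain C where C: "closedin mtopology C" "B = C \<inter> Z" by (auto simp: closedin_subtopology)
    show "x \<in> B"
    proof (rule ccontr)
      assume "x \<notin> B"
      then obtain r where r: "r > 0" "disjnt C (mball x r)"
        using C x Z(1) unfolding closedin_metric by blast
      obtain b where b: "b \<in> B" "d x b < r" using near r by blast
      then have "b \<in> mball x r" using BM x Z(1) by auto
      then show False using r b C by (auto simp: disjnt_iff)
    qed
  next
    assume sep: "\<forall>x\<in>Z. (\<forall>e>0. \<exists>b\<in>B. d x b < e) \<longrightarrow> x \<in> B"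
    have open_nbhd: "openin ?Y (?q ` (Z \<inter> mball f r))" if f: "f \<in> Z" for f r
    proof -
      \<comment> \<open>The saturation of a ball is the union of its translates by \<open>B\<close>,
        which are again balls by invariance of \<open>d\<close>; hence the quotient map is open on
        balls.\<close>
      have "{x \<in> Z. ?q x \<in> ?q ` (Z \<inter> mball f r)} = Z \<inter> (\<Union>b\<in>B. mball (f + b) r)"
      proof (intro subset_antisym subsetI)
        fix x assume "x \<in> {x \<in> Z. ?q x \<in> ?q ` (Z \<inter> mball f r)}"
        then obtain y where xy: "x \<in> Z" "y \<in> Z" "y \<in> mball f r" "x - y \<in> B"
          by (auto simp: coset_eq_iff[OF B(2)])
        let ?b = "x - y"
        have "f + ?b \<in> Z" using xy f B Z by (auto intro: add_subgroup_add)
        moreover have "d (f + ?b) x = d f y"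
          using inv[of "f + ?b" x ?b] calculation xy B by (simp add: subset_eq)
        ultimately show "x \<in> Z \<inter> (\<Union>b\<in>B. mball (f + b) r)"
          using xy Z(1) by (intro IntI UN_I[of ?b]) (auto simp: subset_eq)
      next
        fix x assume "x \<in> Z \<inter> (\<Union>b\<in>B. mball (f + b) r)"
        then obtain b where xb: "x \<in> Z" "b \<in> B" "d (f + b) x < r" by auto
        have "f + b \<in> Z" "x - b \<in> Z" using xb f B Z by (auto intro: add_subgroup_add add_subgroup_diff)
        moreover have "d f (x - b) = d (f + b) x"
          using inv[of "f + b" x b] calculation xb B by auto
        moreover have "?q x = ?q (x - b)" using xb by (simp add: coset_eq_iff[OF B(2)])
        ultimately show "x \<in> {x \<in> Z. ?q x \<in> ?q ` (Z \<inter> mball f r)}"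
          using xb f Z(1) by (simp add: image_iff) (metis IntI in_mball subsetD)
      qed
      then have "openin ?X {x \<in> topspace ?X. ?q x \<in> ?q ` (Z \<inter> mball f r)}"
        unfolding tX openin_subtopology by (intro exI[of _ "\<Union>b\<in>B. mball (f + b) r"]) auto
      then show ?thesis unfolding openin_quotient_topology tX by auto
    qed
    show "Hausdorff_space ?Y"
      unfolding Hausdorff_space_def
    proof (intro allI impI)
      fix P Q assume PQ: "P \<in> topspace ?Y \<and> Q \<in> topspace ?Y \<and> P \<noteq> Q"
      then obtain f g where fg: "f \<in> Z" "g \<in> Z" "P = ?q f" "Q = ?q g" "f - g \<notin> B"
        unfolding topspace_quotient_topology tX using coset_eq_iff[OF B(2)] by blast
      have fgZ: "f - g \<in> Z" using fg Z by (auto intro: add_subgroup_diff)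
      then obtain e where e: "e > 0" "\<And>b. b \<in> B \<Longrightarrow> d (f - g) b \<ge> e"
        using sep fg by (meson not_le)
      \<comment> \<open>If the two images met, \<open>z - w\<close> would be an element of
        \<open>B\<close> at distance less than \<open>e\<close> from \<open>f - g\<close>.\<close>
      have "z +o B \<noteq> w +o B" if zw: "z \<in> Z \<inter> mball f (e/2)" "w \<in> Z \<inter> mball g (e/2)" for z w
      proof
        assume "z +o B = w +o B"
        then have b: "z - w \<in> B" (is "?b \<in> B") by (simp add: coset_eq_iff[OF B(2)])
        then have bg: "?b \<in> Z" "?b + g \<in> Z" using fg B Z by (auto intro: add_subgroup_add)
        have "d (f - g) ?b = d f (?b + g)" using inv[of f "?b + g" g] fg bg by simp
        also have "\<dots> \<le> d f z + d z (?b + g)" using fg bg zw Z by (intro triangle) auto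
        also have "d z (?b + g) = d w g" using inv[of z "?b + g" ?b] zw bg by simp
        also have "d f z + d w g < e" using zw by (auto simp: commute)
        finally show False using e(2)[OF b] by simp
      qed
      then have "disjnt (?q ` (Z \<inter> mball f (e/2))) (?q ` (Z \<inter> mball g (e/2)))"
        by (auto simp: disjnt_iff)
      moreover have "P \<in> ?q ` (Z \<inter> mball f (e/2))" "Q \<in> ?q ` (Z \<inter> mball g (e/2))"
        using fg e Z by auto
      ultimately show "\<exists>U V. openin ?Y U \<and> openin ?Y V \<and> P \<in> U \<and> Q \<in> V \<and> disjnt U V"
        using open_nbhd[OF fg(1)] open_nbhd[OF fg(2)] by (intro exI conjI)
    qed
  qed
qed

section \<open>Subgroups of bounded and of null sequences\<close>

lemma add_subgroup_bounded_seqs: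
  fixes nrm :: "'v::ab_group_add \<Rightarrow> real"
  assumes "add_subgroup V" and "\<And>x y. x \<in> V \<Longrightarrow> y \<in> V \<Longrightarrow> nrm (x - y) \<le> nrm x + nrm y"
  shows "add_subgroup (bounded_seqs V nrm)"
  unfolding add_subgroup_def
proof (intro conjI ballI)
  show "0 \<in> bounded_seqs V nrm" using assms(1) by (auto simp: bounded_seqs_def add_subgroup_0)
  fix x y assume xy: "x \<in> bounded_seqs V nrm" "y \<in> bounded_seqs V nrm"
  then obtain B C where "\<And>k. nrm (x k) \<le> B" "\<And>k. nrm (y k) \<le> C" by (auto simp: bounded_seqs_def)
  then have "nrm (x k - y k) \<le> B + C" for k
    using assms(2)[of "x k" "y k"] xy by (force simp: bounded_seqs_def intro: order_trans add_mono)
  then show "x - y \<in> bounded_seqs V nrm"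
    using xy add_subgroup_diff[OF assms(1)] by (auto simp: bounded_seqs_def)
qed

lemma add_subgroup_null_seqs:
  fixes nrm :: "'v::ab_group_add \<Rightarrow> real"
  assumes V: "add_subgroup V" and tri: "\<And>x y. x \<in> V \<Longrightarrow> y \<in> V \<Longrightarrow> nrm (x - y) \<le> nrm x + nrm y"
    and pos: "\<And>x. x \<in> V \<Longrightarrow> 0 \<le> nrm x" and zero: "nrm 0 = 0"
  shows "add_subgroup (null_seqs U V nrm)"
  unfolding add_subgroup_def
proof (intro conjI ballI)
  note sub = add_subgroup_bounded_seqs[OF V tri]
  show "0 \<in> null_seqs U V nrm" using add_subgroup_0[OF sub] by (simp add: null_seqs_def zero)
  fix x y assume xy: "x \<in> null_seqs U V nrm" "y \<in> null_seqs U V nrm"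
  then have V': "x k \<in> V" "y k \<in> V" for k by (auto simp: null_seqs_def bounded_seqs_def)
  have "((\<lambda>k. nrm (x k) + nrm (y k)) \<longlongrightarrow> 0 + 0) U"
    using xy by (intro tendsto_add) (auto simp: null_seqs_def)
  then have lim: "((\<lambda>k. nrm (x k) + nrm (y k)) \<longlongrightarrow> 0) U" by simp
  have "((\<lambda>k. nrm (x k - y k)) \<longlongrightarrow> 0) U"
  proof (rule Lim_null_comparison[OF always_eventually lim], rule allI)
    show "norm (nrm (x k - y k)) \<le> nrm (x k) + nrm (y k)" for k
      using tri[OF V'] pos[OF add_subgroup_diff[OF V V']] by simp
  qed
  then show "x - y \<in> null_seqs U V nrm"
    using xy add_subgroup_diff[OF sub] by (simp add: null_seqs_def)
qed

section \<open>The bar complex\<close>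

text \<open>
  The alternating sum of the terms of the codifferential other than the first one, up to sign and as
  a function of \<open>\<gamma>\<^sub>1\<close> and the list \<open>\<gamma>\<^sub>2, \<dots>, \<gamma>\<^sub>n\<close>.  This recursive form turns \<open>d \<circ> d = 0\<close> into
  \<open>merge_sum_merge_sum\<close>, without any double sums.
\<close>

fun merge_sum :: "('g, 'm) monoid_scheme \<Rightarrow> ('g list \<Rightarrow> 'e::real_vector) \<Rightarrow> 'g \<Rightarrow> 'g list \<Rightarrow> 'e" where
  "merge_sum G f x [] = f []"
| "merge_sum G f x (y # ys) = f ((x \<otimes>\<^bsub>G\<^esub> y) # ys) - merge_sum G (\<lambda>zs. f (x # zs)) y ys"

lemma merge_sum_diff: "merge_sum G (\<lambda>zs. f zs - g zs) x ys = merge_sum G f x ys - merge_sum G g x ys"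
  by (induction ys arbitrary: f g x) auto

lemma merge_sum_scaleR: "merge_sum G (\<lambda>zs. c *\<^sub>R f zs) x ys = c *\<^sub>R merge_sum G f x ys"
  by (induction ys arbitrary: f x) (auto simp: scaleR_diff_right)

lemma norm_merge_sum_le:
  assumes "\<And>zs. norm (f zs) \<le> B"
  shows "norm (merge_sum G f x ys) \<le> real (length ys + 1) * B"
  using assms
proof (induction ys arbitrary: f x)
  case (Cons y ys)
  have "norm (merge_sum G f x (y # ys))
      \<le> norm (f ((x \<otimes>\<^bsub>G\<^esub> y) # ys)) + norm (merge_sum G (\<lambda>zs. f (x # zs)) y ys)"
    by (simp add: norm_triangle_ineq4)
  also have "\<dots> \<le> B + real (length ys + 1) * B"
    by (intro add_mono Cons)
  finally show ?case by (simp add: algebra_simps)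
qed simp

text \<open>The formula \<open>codifferential_Cons\<close> is valid on tuples only; this allows it
  to be used underneath \<open>merge_sum\<close>, which evaluates its function at tuples
  only.\<close>

lemma (in group) merge_sum_cong:
  assumes "x \<in> carrier G" "set ys \<subseteq> carrier G"
    and "\<And>zs. zs \<in> tuples G (length ys) \<Longrightarrow> f zs = g zs"
  shows "merge_sum G f x ys = merge_sum G g x ys"
  using assms
proof (induction ys arbitrary: f g x)
  case (Cons y ys)
  have "merge_sum G (\<lambda>zs. f (x # zs)) y ys = merge_sum G (\<lambda>zs. g (x # zs)) y ys"
    using Cons.prems by (intro Cons.IH) (auto simp: tuples_def)
  then show ?case using Cons.prems by (simp add: tuples_def)
qed (simp add: tuples_def)

text \<open>After unfolding, the induction hypothesis for \<open>\<lambda>w. f (x # w)\<close> makes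
  the two terms that keep \<open>x\<close> as a separate entry cancel. Associativity identifies the
  rest with one recursion step at \<open>x \<otimes> y\<close>.\<close>

lemma (in group) merge_sum_merge_sum:
  assumes "x \<in> carrier G" "y \<in> carrier G" "set ys \<subseteq> carrier G"
  shows "merge_sum G (merge_sum G f x) y ys = merge_sum G f (x \<otimes> y) ys"
  using assms
proof (induction ys arbitrary: f x y)
  case (Cons z zs)
  have "merge_sum G (merge_sum G f x) y (z # zs) =
      f ((x \<otimes> (y \<otimes> z)) # zs) - merge_sum G (\<lambda>w. f (x # w)) (y \<otimes> z) zs
      - (merge_sum G (\<lambda>w. f ((x \<otimes> y) # w)) z zs - merge_sum G (merge_sum G (\<lambda>w. f (x # w)) y) z zs)"
    by (simp add: merge_sum_diff)
  also have "\<dots> = merge_sum G f (x \<otimes> y) (z # zs)"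
    using Cons by (simp add: m_assoc)
  finally show ?case .
qed simp

text \<open>Links the recursion to the alternating sum. The summand with index 1 is the only one
  that merges \<open>x\<close>; in the others \<open>x\<close> is carried along in front, and the
  index shift by 1 flips the sign.\<close>

lemma merge_sum_eq_sum:
  "merge_sum G f x ys =
     - (\<Sum>i = 1..length ys. (- 1) ^ i *\<^sub>R
         f (take (i - 1) (x # ys) @ [(x # ys) ! (i - 1) \<otimes>\<^bsub>G\<^esub> (x # ys) ! i] @ drop (i + 1) (x # ys)))
     - (- 1) ^ (length ys + 1) *\<^sub>R f (butlast (x # ys))"
proof (induction ys arbitrary: f x)
  case (Cons y ys)
  let ?t = "\<lambda>f zs i. (- 1::real) ^ i *\<^sub>R f (take (i - 1) zs @ [zs ! (i - 1) \<otimes>\<^bsub>G\<^esub> zs ! i] @ drop (i + 1) zs)"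
  have "?t f (x # y # ys) (Suc i) = - ?t (\<lambda>zs. f (x # zs)) (y # ys) i" if "i \<ge> 1" for i
    using that by (cases i) auto
  then have "(\<Sum>i = 1..length ys. ?t f (x # y # ys) (Suc i)) =
      - (\<Sum>i = 1..length ys. ?t (\<lambda>zs. f (x # zs)) (y # ys) i)"
    by (simp only: sum_negf[symmetric]) (rule sum.cong, auto)
  moreover have "(\<Sum>i = 1..length (y # ys). ?t f (x # y # ys) i)
      = ?t f (x # y # ys) 1 + (\<Sum>i = 1..length ys. ?t f (x # y # ys) (Suc i))"
    by (simp add: sum.atLeast_Suc_atMost sum.atLeast_Suc_atMost_Suc_shift del: sum.cl_ivl_Suc)
  ultimately show ?case
    by (simp only: Cons.IH merge_sum.simps) simp
qed simp

lemma codifferential_Cons: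
  assumes "x # ys \<in> tuples G n"
  shows "codifferential G act n f (x # ys) = act x (f ys) - merge_sum G f x ys"
proof -
  have "n = length ys + 1" using assms by (simp add: tuples_def)
  then show ?thesis
    using assms unfolding codifferential_def merge_sum_eq_sum[of G f x ys] by simp
qed

context banach_module
begin

sublocale group G
  using group_hom by (simp add: group_hom_def)

lemma act_mult:
  "g \<in> carrier G \<Longrightarrow> h \<in> carrier G \<Longrightarrow> act (g \<otimes> h) x = act g (act h x)"
  using composition_rule[of x g h] by simp

lemma act_diff: "g \<in> carrier G \<Longrightarrow> act g (x - y) = act g x - act g y"
  using linear_diff[OF linear_act] .

lemma merge_sum_act:
  "g \<in> carrier G \<Longrightarrow> merge_sum G (\<lambda>zs. act g (f zs)) x ys = act g (merge_sum G f x ys)"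
  by (induction ys arbitrary: f x) (auto simp: act_diff)

text \<open>At \<open>x # y # ys\<close> the terms cancel in three pairs: two actions by
  \<open>act_mult\<close>, an action combined with a merge by \<open>merge_sum_act\<close>, and two
  merges by \<open>merge_sum_merge_sum\<close>.\<close>

lemma codifferential_codifferential:
  assumes n: "n \<ge> 1"
  shows "codifferential G act (n + 1) (codifferential G act n f) = 0"
proof
  fix xs
  show "codifferential G act (n + 1) (codifferential G act n f) xs = 0 xs"
  proof (cases "xs \<in> tuples G (n + 1)")
    case True
    then obtain x y ys where xs: "xs = x # y # ys"
      using n by (cases xs; cases "tl xs") (auto simp: tuples_def)
    have c: "x \<in> carrier G" "y \<in> carrier G" "set ys \<subseteq> carrier G" "length ys = n - 1"
      using True by (auto simp: xs tuples_def)
    let ?D = "codifferential G act n f"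
    have D: "?D (z # zs) = act z (f zs) - merge_sum G f z zs"
      if "z \<in> carrier G" "zs \<in> tuples G (length ys)" for z zs
      using that c n by (intro codifferential_Cons) (auto simp: tuples_def)
    have ys: "ys \<in> tuples G (length ys)" using c by (simp add: tuples_def)
    have "merge_sum G (\<lambda>zs. ?D (x # zs)) y ys = merge_sum G (\<lambda>zs. act x (f zs) - merge_sum G f x zs) y ys"
      using c D by (intro merge_sum_cong) auto
    also have "\<dots> = act x (merge_sum G f y ys) - merge_sum G f (x \<otimes> y) ys"
      using c by (simp add: merge_sum_diff merge_sum_act merge_sum_merge_sum)
    finally show ?thesis
      using True c ys by (simp add: xs codifferential_Cons D act_diff act_mult)
  qed (simp add: codifferential_def)
qed

end

section \<open>Banach spaces of cochains\<close>

text \<open>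
  Bounded functions on a set are bounded continuous functions on a discrete copy of it, which gives
  access to the Banach space structure of the library.
\<close>

instance bcontfun :: (metric_space, banach) banach ..

definition to_bcf :: "('a \<Rightarrow> 'e::real_normed_vector) \<Rightarrow> 'a discrete \<Rightarrow>\<^sub>C 'e" where
  "to_bcf f = Bcontfun (\<lambda>d. f (of_discrete d))"

definition of_bcf :: "('a discrete \<Rightarrow>\<^sub>C 'e::real_normed_vector) \<Rightarrow> 'a \<Rightarrow> 'e" where
  "of_bcf F x = apply_bcontfun F (discrete x)"

lemma of_bcf_to_bcf: "bounded (range f) \<Longrightarrow> of_bcf (to_bcf f) = f"
proof
  fix x assume "bounded (range f)"
  then have "bounded (range (\<lambda>d. f (of_discrete d)))" by (rule bounded_subset) auto
  then have "(\<lambda>d. f (of_discrete d)) \<in> bcontfun"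
    by (auto simp: bcontfun_def continuous_on_open_invariant open_discrete)
  then show "of_bcf (to_bcf f) x = f x"
    by (simp add: of_bcf_def to_bcf_def Bcontfun_inverse discrete_inverse)
qed

lemma of_bcf_eqD: "of_bcf F = of_bcf H \<Longrightarrow> F = H"
  by (rule bcontfun_eqI) (metis of_bcf_def of_discrete_inverse)

lemma bounded_of_bcf: "bounded (range (of_bcf F))"
  by (rule bounded_subset[OF bounded_apply_bcontfun[of F]]) (auto simp: of_bcf_def)

lemma of_bcf_0: "of_bcf 0 = 0"
  and of_bcf_add: "of_bcf (F + H) = of_bcf F + of_bcf H"
  and of_bcf_diff: "of_bcf (F - H) = of_bcf F - of_bcf H"
  and of_bcf_scaleR: "of_bcf (c *\<^sub>R F) = (\<lambda>x. c *\<^sub>R of_bcf F x)"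
  by (auto simp: of_bcf_def)

lemma sup_norm_of_bcf: "sup_norm (of_bcf F) = norm F"
proof (rule antisym)
  show "sup_norm (of_bcf F) \<le> norm F"
    unfolding sup_norm_def by (rule cSUP_least) (auto simp: of_bcf_def norm_bounded)
  have "bdd_above (range (\<lambda>x. norm (of_bcf F x)))"
    using norm_bounded[of F] by (auto simp: of_bcf_def intro!: bdd_aboveI2)
  then have "norm (of_bcf F (of_discrete d)) \<le> sup_norm (of_bcf F)" for d
    unfolding sup_norm_def by (rule cSUP_upper[OF UNIV_I])
  then show "norm F \<le> sup_norm (of_bcf F)"
    by (intro norm_bound) (simp add: of_bcf_def of_discrete_inverse)
qed

lemma cochains_iff:
  "f \<in> cochains G n \<longleftrightarrow> bounded (range f) \<and> (\<forall>xs. xs \<notin> tuples G n \<longrightarrow> f xs = 0)"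
proof -
  have "bounded (range f)" if "bounded (f ` tuples G n)" "\<forall>xs. xs \<notin> tuples G n \<longrightarrow> f xs = 0"
  proof (rule bounded_subset)
    show "bounded (insert 0 (f ` tuples G n))" using that(1) by simp
  qed (use that(2) in auto)
  moreover have "bounded (f ` tuples G n)" if "bounded (range f)"
    using that by (rule bounded_subset) auto
  ultimately show ?thesis unfolding cochains_def by blast
qed

text \<open>Cochains of all degrees become closed subspaces of one Banach space type. This is why
  the results on exact sequences carry subspaces \<open>A\<close> and \<open>B\<close>.\<close>

definition cochain_space :: "('g, 'm) monoid_scheme \<Rightarrow> nat \<Rightarrow> ('g list discrete \<Rightarrow>\<^sub>C 'e::real_normed_vector) set" where
  "cochain_space G n = {F. of_bcf F \<in> cochains G n}"

lemma cochain_space_iff: "F \<in> cochain_space G n \<longleftrightarrow> (\<forall>xs. xs \<notin> tuples G n \<longrightarrow> of_bcf F xs = 0)"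
  by (simp add: cochain_space_def cochains_iff bounded_of_bcf)

lemma of_to_bcf_cochain: "f \<in> cochains G n \<Longrightarrow> of_bcf (to_bcf f) = f"
  by (rule of_bcf_to_bcf) (simp add: cochains_iff)

lemma subspace_cochain_space: "subspace (cochain_space G n)"
  by (auto simp: subspace_def cochain_space_iff of_bcf_0 of_bcf_add of_bcf_scaleR)

lemma bounded_linear_of_bcf: "bounded_linear (\<lambda>F. of_bcf F xs)"
  by (rule bounded_linear_intro[of _ 1]) (auto simp: of_bcf_def norm_bounded)

lemma closed_cochain_space:
  "closed (cochain_space G n :: ('g list discrete \<Rightarrow>\<^sub>C 'e::real_normed_vector) set)"
proof -
  have "closed {F :: 'g list discrete \<Rightarrow>\<^sub>C 'e. of_bcf F xs = 0}" for xs
    by (intro closed_Collect_eq bounded_linear.continuous_on[OF bounded_linear_of_bcf] continuous_intros)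
  moreover have "cochain_space G n = (\<Inter>xs\<in>- tuples G n. {F :: 'g list discrete \<Rightarrow>\<^sub>C 'e. of_bcf F xs = 0})"
    by (auto simp: cochain_space_iff)
  ultimately show ?thesis by (simp add: closed_INT)
qed

lemma sup_norm_to_bcf: "f \<in> cochains G n \<Longrightarrow> norm (to_bcf f) = sup_norm f"
  by (metis of_to_bcf_cochain sup_norm_of_bcf)

lemma to_bcf_in_cochain_space: "f \<in> cochains G n \<Longrightarrow> to_bcf f \<in> cochain_space G n"
  by (simp add: cochain_space_def of_to_bcf_cochain)

lemma image_of_bcf_cochain_space: "of_bcf ` cochain_space G n = (cochains G n :: ('g list \<Rightarrow> 'e::real_normed_vector) set)"
proof (intro subset_antisym subsetI)
  fix f :: "'g list \<Rightarrow> 'e" assume "f \<in> cochains G n"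
  then show "f \<in> of_bcf ` cochain_space G n"
    by (intro image_eqI[of _ _ "to_bcf f"]) (simp_all add: of_to_bcf_cochain to_bcf_in_cochain_space)
qed (auto simp: cochain_space_def)

lemma cochains_cases:
  assumes "f \<in> cochains G n"
  obtains F where "f = of_bcf F" "F \<in> cochain_space G n"
  using assms unfolding image_of_bcf_cochain_space[symmetric] by blast

lemma add_subgroup_cochains: "add_subgroup (cochains G n)"
  unfolding add_subgroup_def
proof (intro conjI ballI)
  show "0 \<in> cochains G n" by (simp add: cochains_def image_constant_conv)
  show "f - g \<in> cochains G n" if "f \<in> cochains G n" "g \<in> cochains G n" for f g
    unfolding fun_diff_def using that by (rule diff_cochain)
qed

lemma sup_norm_diff_le:
  assumes "f \<in> cochains G n" "g \<in> cochains G n"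
  shows "sup_norm (f - g) \<le> sup_norm f + sup_norm g"
proof -
  obtain F H where "f = of_bcf F" "g = of_bcf H" using assms by (metis cochains_cases)
  then show ?thesis by (simp only: of_bcf_diff[symmetric] sup_norm_of_bcf norm_triangle_ineq4)
qed

lemma sup_norm_zero: "sup_norm 0 = 0"
  by (simp add: sup_norm_def)

lemma sup_norm_nonneg: "f \<in> cochains G n \<Longrightarrow> 0 \<le> sup_norm f"
  by (metis norm_ge_zero sup_norm_to_bcf)

section \<open>The codifferential as a bounded operator\<close>

context banach_module
begin

lemma norm_codifferential_le:
  assumes n: "n \<ge> 1" and B: "\<And>zs. norm (f zs) \<le> B"
  shows "norm (codifferential G act n f xs) \<le> real (n + 1) * B"
proof (cases "xs \<in> tuples G n")
  case True
  then obtain x ys where xs: "xs = x # ys" "x \<in> carrier G" "n = length ys + 1"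
    using n by (cases xs) (auto simp: tuples_def)
  have "norm (codifferential G act n f xs) \<le> norm (act x (f ys)) + norm (merge_sum G f x ys)"
    using True by (simp add: xs codifferential_Cons norm_triangle_ineq4)
  also have "\<dots> \<le> B + real (length ys + 1) * B"
    by (intro add_mono norm_merge_sum_le B) (simp add: norm_act xs B)
  finally show ?thesis by (simp add: xs algebra_simps)
next
  case False
  moreover have "0 \<le> B" using B norm_ge_zero order_trans by blast
  ultimately show ?thesis by (simp add: codifferential_def)
qed

lemma codifferential_diff:
  assumes n: "n \<ge> 1"
  shows "codifferential G act n (f - g) = codifferential G act n f - codifferential G act n g"
proof
  fix xs
  show "codifferential G act n (f - g) xs = (codifferential G act n f - codifferential G act n g) xs"
  proof (cases "xs \<in> tuples G n")
    case True
    then obtain x ys where xs: "xs = x # ys" "x \<in> carrier G"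
      using n by (cases xs) (auto simp: tuples_def)
    show ?thesis using True
      by (simp add: xs codifferential_Cons act_diff merge_sum_diff fun_diff_def algebra_simps)
  qed (simp add: codifferential_def)
qed

lemma codifferential_scaleR:
  assumes n: "n \<ge> 1"
  shows "codifferential G act n (\<lambda>xs. c *\<^sub>R f xs) = (\<lambda>xs. c *\<^sub>R codifferential G act n f xs)"
proof
  fix xs
  show "codifferential G act n (\<lambda>xs. c *\<^sub>R f xs) xs = c *\<^sub>R codifferential G act n f xs"
  proof (cases "xs \<in> tuples G n")
    case True
    then obtain x ys where xs: "xs = x # ys" "x \<in> carrier G"
      using n by (cases xs) (auto simp: tuples_def)
    show ?thesis using True
      by (simp add: xs codifferential_Cons merge_sum_scaleR linear_scale[OF linear_act] scaleR_diff_right)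
  qed (simp add: codifferential_def)
qed

lemma codifferential_0: "n \<ge> 1 \<Longrightarrow> codifferential G act n 0 = 0"
  using codifferential_diff[of n 0 0] by simp

lemma codifferential_add:
  assumes "n \<ge> 1"
  shows "codifferential G act n (f + g) = codifferential G act n f + codifferential G act n g"
  using codifferential_diff[OF assms, of "f + g" g] by (simp add: algebra_simps)

text \<open>Acts on the whole type rather than on cochains alone, so that it can be a
  \<open>bounded_linear\<close> map. For \<open>n \<ge> 1\<close> the codifferential of any bounded
  function is bounded, so \<open>to_bcf\<close> loses nothing.\<close>

definition codiff :: "nat \<Rightarrow> ('g list discrete \<Rightarrow>\<^sub>C 'e) \<Rightarrow> 'g list discrete \<Rightarrow>\<^sub>C 'e" where
  "codiff n F = to_bcf (codifferential G act n (of_bcf F))"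

lemma of_bcf_codiff:
  assumes "n \<ge> 1"
  shows "of_bcf (codiff n F) = codifferential G act n (of_bcf F)"
proof -
  have "norm (of_bcf F zs) \<le> norm F" for zs by (simp add: of_bcf_def norm_bounded)
  from norm_codifferential_le[of n "of_bcf F" "norm F", OF assms this]
  have "bounded (range (codifferential G act n (of_bcf F)))" by (auto simp: bounded_iff)
  then show ?thesis by (simp add: codiff_def of_bcf_to_bcf)
qed

lemma bounded_linear_codiff:
  assumes n: "n \<ge> 1"
  shows "bounded_linear (codiff n)"
proof (rule bounded_linear_intro)
  show "codiff n (F + H) = codiff n F + codiff n H" for F H
    by (rule of_bcf_eqD) (simp only: of_bcf_codiff[OF n] of_bcf_add codifferential_add[OF n])
  show "codiff n (c *\<^sub>R F) = c *\<^sub>R codiff n F" for c F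
    by (rule of_bcf_eqD) (simp only: of_bcf_codiff[OF n] of_bcf_scaleR codifferential_scaleR[OF n])
  fix F :: "'g list discrete \<Rightarrow>\<^sub>C 'e"
  have "norm (of_bcf F zs) \<le> norm F" for zs by (simp add: of_bcf_def norm_bounded)
  from norm_codifferential_le[of n "of_bcf F" "norm F", OF n this]
  show "norm (codiff n F) \<le> norm F * real (n + 1)"
    unfolding sup_norm_of_bcf[symmetric, of "codiff n F"] of_bcf_codiff[OF n] sup_norm_def
    by (intro cSUP_least) (auto simp: mult.commute)
qed

lemma of_bcf_image_codiff:
  assumes "n \<ge> 1"
  shows "of_bcf ` codiff n ` cochain_space G (n - 1) = bounded_coboundaries G act n"
  using assms by (simp add: bounded_coboundaries_def image_image of_bcf_codiff
      image_of_bcf_cochain_space[symmetric])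

lemma of_bcf_kernel_codiff:
  "of_bcf ` {F \<in> cochain_space G n. codiff (n + 1) F = 0} = bounded_cocycles G act n"
proof -
  have "codiff (n + 1) F = 0 \<longleftrightarrow> codifferential G act (n + 1) (of_bcf F) = 0" for F
    using of_bcf_codiff[of "n + 1" F] of_bcf_0 of_bcf_eqD by (metis le_add2)
  then show ?thesis
    unfolding bounded_cocycles_def image_of_bcf_cochain_space[symmetric] by blast
qed

lemma coboundaries_subset_cocycles:
  assumes "n \<ge> 1"
  shows "bounded_coboundaries G act n \<subseteq> bounded_cocycles G act n"
  using assms codifferential_in_cochains codifferential_codifferential
  by (auto simp: bounded_coboundaries_def bounded_cocycles_def)

lemma of_bcf_in_image_iff: "of_bcf F \<in> of_bcf ` S \<longleftrightarrow> F \<in> S"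
  using of_bcf_eqD by blast

lemma image_codiff_subset_kernel:
  assumes n: "n \<ge> 1"
  shows "codiff n ` cochain_space G (n - 1) \<subseteq> {F \<in> cochain_space G n. codiff (n + 1) F = 0}"
proof
  fix F assume "F \<in> codiff n ` cochain_space G (n - 1)"
  then have "of_bcf F \<in> bounded_cocycles G act n"
    using coboundaries_subset_cocycles[OF n] of_bcf_image_codiff[OF n] by blast
  then show "F \<in> {F \<in> cochain_space G n. codiff (n + 1) F = 0}"
    unfolding of_bcf_kernel_codiff[symmetric] of_bcf_in_image_iff .
qed

lemma add_subgroup_cocycles: "add_subgroup (bounded_cocycles G act n)"
  unfolding add_subgroup_def
  using add_subgroup_0[OF add_subgroup_cochains] add_subgroup_diff[OF add_subgroup_cochains]
  by (auto simp: bounded_cocycles_def codifferential_0 codifferential_diff)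

lemma add_subgroup_coboundaries:
  assumes n: "n \<ge> 1"
  shows "add_subgroup (bounded_coboundaries G act n)"
proof -
  have b: "bounded_coboundaries G act n = codifferential G act n ` cochains G (n - 1)"
    using n by (simp add: bounded_coboundaries_def)
  note C = add_subgroup_cochains[of G "n - 1"]
  show ?thesis
    unfolding add_subgroup_def b
  proof (intro conjI ballI)
    show "0 \<in> codifferential G act n ` cochains G (n - 1)"
      using codifferential_0[OF n] add_subgroup_0[OF C] by (metis imageI)
    show "x - y \<in> codifferential G act n ` cochains G (n - 1)"
      if "x \<in> codifferential G act n ` cochains G (n - 1)" "y \<in> codifferential G act n ` cochains G (n - 1)" for x y
      using that codifferential_diff[OF n, symmetric] by (auto intro!: imageI diff_cochain)
  qed
qed

section \<open>Vanishing and Hausdorffness of bounded cohomology\<close>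

lemma bounded_cohomology_vanishes_iff:
  assumes n: "n \<ge> 1"
  shows "bounded_cohomology_vanishes G act n \<longleftrightarrow> bounded_cocycles G act n \<subseteq> bounded_coboundaries G act n"
  unfolding bounded_cohomology_vanishes_def bounded_cohomology_def
proof (rule quotient_space_eq_singleton_iff[where e = 0])
  note B = add_subgroup_coboundaries[OF n]
  show "0 \<in> bounded_coboundaries G act n" by (rule add_subgroup_0[OF B])
  show "bounded_coboundaries G act n \<subseteq> bounded_cocycles G act n"
    by (rule coboundaries_subset_cocycles[OF n])
  show "\<exists>y\<in>bounded_coboundaries G act n. x + y = 0" if "x \<in> bounded_coboundaries G act n" for x
    using add_subgroup_uminus[OF B that] by (intro bexI[of _ "- x"]) auto
qed (auto intro: add_subgroup_add[OF add_subgroup_coboundaries[OF n]])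

lemma Hausdorff_bounded_cohomology_iff:
  assumes n: "n \<ge> 1"
  shows "Hausdorff_space (bounded_cohomology_topology G act n) \<longleftrightarrow>
    (\<forall>f\<in>bounded_cocycles G act n.
       (\<forall>e>0. \<exists>b\<in>bounded_coboundaries G act n. sup_norm (f - b) < e) \<longrightarrow> f \<in> bounded_coboundaries G act n)"
proof -
  have sub: "bounded_cocycles G act n \<subseteq> cochains G n" by (auto simp: bounded_cocycles_def)
  note BZ = coboundaries_subset_cocycles[OF n]
  have dist: "cochain_dist G n f g = sup_norm (f - g)" if "f \<in> bounded_cocycles G act n" "g \<in> bounded_cocycles G act n" for f g
    using that sub by (auto simp: cochain_dist_def fun_diff_def)
  have "Hausdorff_space (bounded_cohomology_topology G act n) \<longleftrightarrow>
    (\<forall>f\<in>bounded_cocycles G act n.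
       (\<forall>e>0. \<exists>b\<in>bounded_coboundaries G act n. cochain_dist G n f b < e) \<longrightarrow> f \<in> bounded_coboundaries G act n)"
    unfolding bounded_cohomology_topology_def cochain_topology_def
  proof (rule Hausdorff_space_quotient_iff[OF Metric_space_cochains sub add_subgroup_cocycles BZ
      add_subgroup_coboundaries[OF n]])
    fix x y z
    assume "x \<in> bounded_cocycles G act n" "y \<in> bounded_cocycles G act n" "z \<in> bounded_cocycles G act n"
    then show "cochain_dist G n (x - z) (y - z) = cochain_dist G n x y"
      by (simp add: dist add_subgroup_diff[OF add_subgroup_cocycles])
  qed
  then show ?thesis using BZ dist by (simp add: subset_eq)
qed

text \<open>The general criterion speaks of the closure of the coboundaries within the cocycles. As
  a kernel of a continuous map the cocycles are closed, so this is the closure in the whole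
  space.\<close>

lemma Hausdorff_bounded_cohomology_iff_closed:
  assumes n: "n \<ge> 1"
  shows "Hausdorff_space (bounded_cohomology_topology G act n) \<longleftrightarrow> closed (codiff n ` cochain_space G (n - 1))"
proof -
  let ?Z = "{F \<in> cochain_space G n. codiff (n + 1) F = 0}" and ?B = "codiff n ` cochain_space G (n - 1)"
  have Z: "closed ?Z"
    using closed_Int[OF closed_cochain_space[of G n] closed_Collect_eq[OF bounded_linear.continuous_on[OF
        bounded_linear_codiff[of "n + 1"] continuous_on_id] continuous_on_const, of 0]]
    by (simp add: Collect_conj_eq)
  have clo: "(\<forall>e>0. \<exists>b\<in>of_bcf ` ?B. sup_norm (of_bcf F - b) < e) \<longleftrightarrow> F \<in> closure ?B" for F
    unfolding closure_approachable
    by (simp add: of_bcf_diff[symmetric] sup_norm_of_bcf dist_norm norm_minus_commute)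
  have "Hausdorff_space (bounded_cohomology_topology G act n) \<longleftrightarrow> (\<forall>F\<in>?Z. F \<in> closure ?B \<longrightarrow> F \<in> ?B)"
    unfolding Hausdorff_bounded_cohomology_iff[OF n] of_bcf_image_codiff[OF n, symmetric]
      of_bcf_kernel_codiff[symmetric] ball_simps(9) clo of_bcf_in_image_iff ..
  also have "\<dots> \<longleftrightarrow> closure ?B \<subseteq> ?B"
    using closure_minimal[OF image_codiff_subset_kernel[OF n] Z] by blast
  also have "\<dots> \<longleftrightarrow> closed ?B"
    using closure_subset[of ?B] closed_closure[of ?B] closure_closed[of ?B] by (metis subset_antisym order_refl)
  finally show ?thesis .
qed

section \<open>Sequences of cochains\<close>

abbreviation bseqs :: "nat \<Rightarrow> (nat \<Rightarrow> 'g list \<Rightarrow> 'e) set" where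
  "bseqs n \<equiv> bounded_seqs (cochains G n) sup_norm"

abbreviation nseqs :: "nat filter \<Rightarrow> nat \<Rightarrow> (nat \<Rightarrow> 'g list \<Rightarrow> 'e) set" where
  "nseqs U n \<equiv> null_seqs U (cochains G n) sup_norm"

lemma add_subgroup_bseqs: "add_subgroup (bseqs n)"
  by (rule add_subgroup_bounded_seqs) (auto intro: add_subgroup_cochains sup_norm_diff_le)

lemma add_subgroup_nseqs: "add_subgroup (nseqs U n)"
  by (rule add_subgroup_null_seqs)
    (auto intro: add_subgroup_cochains sup_norm_diff_le sup_norm_nonneg sup_norm_zero)

lemma of_bcf_bseqs_iff:
  "of_bcf \<circ> X \<in> bseqs n \<longleftrightarrow> (\<forall>k. X k \<in> cochain_space G n) \<and> bounded (range X)"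
  by (auto simp: bounded_seqs_def cochain_space_def sup_norm_of_bcf bounded_iff)

lemma of_bcf_nseqs_iff:
  "of_bcf \<circ> X \<in> nseqs U n \<longleftrightarrow>
     (\<forall>k. X k \<in> cochain_space G n) \<and> bounded (range X) \<and> (X \<longlongrightarrow> 0) U"
  by (simp add: null_seqs_def of_bcf_bseqs_iff sup_norm_of_bcf tendsto_norm_zero_iff)

lemma bseqs_cases:
  assumes "x \<in> bseqs n"
  obtains X where "x = of_bcf \<circ> X" "\<And>k. X k \<in> cochain_space G n" "bounded (range X)"
proof -
  have "x = of_bcf \<circ> (to_bcf \<circ> x)"
  proof
    fix k
    have "x k \<in> cochains G n" using assms by (simp add: bounded_seqs_def)
    then show "x k = (of_bcf \<circ> (to_bcf \<circ> x)) k" by (simp add: of_to_bcf_cochain)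
  qed
  then show ?thesis using that of_bcf_bseqs_iff assms by metis
qed

lemma codifferential_of_bcf:
  "n \<ge> 1 \<Longrightarrow> codifferential G act n \<circ> (of_bcf \<circ> X) = of_bcf \<circ> (codiff n \<circ> X)"
  by (auto simp: of_bcf_codiff)

lemma codiff_in_cochain_space:
  assumes "n \<ge> 1" "F \<in> cochain_space G (n - 1)"
  shows "codiff n F \<in> cochain_space G n"
  using codifferential_in_cochains[OF _ assms(1)] assms by (simp add: cochain_space_def of_bcf_codiff)

lemma codifferential_bseqs:
  assumes n: "n \<ge> 1" and x: "x \<in> bseqs (n - 1)"
  shows "codifferential G act n \<circ> x \<in> bseqs n"
proof -
  obtain X where X: "x = of_bcf \<circ> X" "\<And>k. X k \<in> cochain_space G (n - 1)" "bounded (range X)"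
    using bseqs_cases[OF x] by blast
  have "bounded (range (codiff n \<circ> X))"
    using bounded_linear_image[OF X(3) bounded_linear_codiff[OF n]] by (simp add: image_comp)
  then show ?thesis
    unfolding X(1) codifferential_of_bcf[OF n] of_bcf_bseqs_iff
    using X(2) codiff_in_cochain_space[OF n] by simp
qed

lemma codifferential_nseqs:
  assumes n: "n \<ge> 1" and x: "x \<in> nseqs U (n - 1)"
  shows "codifferential G act n \<circ> x \<in> nseqs U n"
proof -
  have b: "x \<in> bseqs (n - 1)" using x by (simp add: null_seqs_def)
  obtain X where X: "x = of_bcf \<circ> X" using bseqs_cases[OF b] by metis
  have "(X \<longlongrightarrow> 0) U" using x unfolding X of_bcf_nseqs_iff by blast
  then have "((\<lambda>k. codiff n (X k)) \<longlongrightarrow> 0) U"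
    using bounded_linear.tendsto_zero[OF bounded_linear_codiff[OF n]] by blast
  then show ?thesis
    using codifferential_bseqs[OF n b]
    unfolding X codifferential_of_bcf[OF n] of_bcf_nseqs_iff of_bcf_bseqs_iff by (simp add: o_def)
qed

text \<open>A translation along \<open>of_bcf\<close>. Membership in \<open>nseqs\<close> demands
  bounded sequences of cochains as well as convergence; \<open>in_bseqs\<close> and
  \<open>cocycle\<close> show that the first part is automatic here.\<close>

lemma ultra_exact_codiff_iff:
  assumes n: "n \<ge> 1"
  shows "ultra_exact U (codiff n) (codiff (n + 1)) (cochain_space G (n - 1)) (cochain_space G n) \<longleftrightarrow>
    (\<forall>x\<in>bseqs n. codifferential G act (n + 1) \<circ> x \<in> nseqs U (n + 1) \<longrightarrow>
       (\<exists>a\<in>bseqs (n - 1). x - (codifferential G act n \<circ> a) \<in> nseqs U n))"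
    (is "?L \<longleftrightarrow> ?R")
proof -
  have diff: "(of_bcf \<circ> X) - (codifferential G act n \<circ> (of_bcf \<circ> Y)) = of_bcf \<circ> (\<lambda>k. X k - codiff n (Y k))"
    for X Y :: "nat \<Rightarrow> _"
    by (auto simp: fun_eq_iff of_bcf_codiff[OF n] of_bcf_diff)
  have in_bseqs: "of_bcf \<circ> (\<lambda>k. X k - codiff n (Y k)) \<in> bseqs n"
    if "of_bcf \<circ> X \<in> bseqs n" "of_bcf \<circ> Y \<in> bseqs (n - 1)" for X Y
    using add_subgroup_diff[OF add_subgroup_bseqs that(1) codifferential_bseqs[OF n that(2)]]
    unfolding diff .
  have cocycle: "codifferential G act (n + 1) \<circ> (of_bcf \<circ> X) \<in> nseqs U (n + 1)
      \<longleftrightarrow> ((\<lambda>k. codiff (n + 1) (X k)) \<longlongrightarrow> 0) U" if "of_bcf \<circ> X \<in> bseqs n" for X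
  proof -
    have "codifferential G act (n + 1) \<circ> (of_bcf \<circ> X) = of_bcf \<circ> (codiff (n + 1) \<circ> X)"
      by (rule codifferential_of_bcf) simp
    moreover have "codifferential G act (n + 1) \<circ> (of_bcf \<circ> X) \<in> bseqs (n + 1)"
      by (rule codifferential_bseqs) (simp_all only: add_diff_cancel_right' that le_add2)
    ultimately show ?thesis
      by (simp only: of_bcf_nseqs_iff of_bcf_bseqs_iff) (simp only: o_def simp_thms)
  qed
  show ?thesis
  proof
    assume L: ?L
    show ?R
    proof (intro ballI impI)
      fix x assume x: "x \<in> bseqs n" and c: "codifferential G act (n + 1) \<circ> x \<in> nseqs U (n + 1)"
      obtain X where X: "x = of_bcf \<circ> X" "\<And>k. X k \<in> cochain_space G n" "bounded (range X)"
        using bseqs_cases[OF x] by blast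
      have "((\<lambda>k. codiff (n + 1) (X k)) \<longlongrightarrow> 0) U" using cocycle x c unfolding X(1) by blast
      then obtain Y where Y: "\<And>k. Y k \<in> cochain_space G (n - 1)" "bounded (range Y)"
          "((\<lambda>k. X k - codiff n (Y k)) \<longlongrightarrow> 0) U"
        using L[unfolded ultra_exact_def, rule_format, of X] X(2,3) by blast
      have Yb: "of_bcf \<circ> Y \<in> bseqs (n - 1)" using Y by (simp add: of_bcf_bseqs_iff)
      have "x - (codifferential G act n \<circ> (of_bcf \<circ> Y)) \<in> nseqs U n"
        using in_bseqs[OF x[unfolded X(1)] Yb] Y(3) unfolding X(1) diff of_bcf_nseqs_iff of_bcf_bseqs_iff by blast
      then show "\<exists>a\<in>bseqs (n - 1). x - (codifferential G act n \<circ> a) \<in> nseqs U n" using Yb by blast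
    qed
  next
    assume R: ?R
    show ?L unfolding ultra_exact_def
    proof (intro allI impI)
      fix X :: "nat \<Rightarrow> 'g list discrete \<Rightarrow>\<^sub>C 'e"
      assume X: "\<forall>k. X k \<in> cochain_space G n" "bounded (range X)" "((\<lambda>k. codiff (n + 1) (X k)) \<longlongrightarrow> 0) U"
      have x: "of_bcf \<circ> X \<in> bseqs n" using X by (simp add: of_bcf_bseqs_iff)
      then obtain a where a: "a \<in> bseqs (n - 1)" "(of_bcf \<circ> X) - (codifferential G act n \<circ> a) \<in> nseqs U n"
        using R cocycle X(3) by blast
      obtain Y where Y: "a = of_bcf \<circ> Y" "\<And>k. Y k \<in> cochain_space G (n - 1)" "bounded (range Y)"
        using bseqs_cases[OF a(1)] by blast
      have "((\<lambda>k. X k - codiff n (Y k)) \<longlongrightarrow> 0) U"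
        using a(2) unfolding Y(1) diff of_bcf_nseqs_iff by blast
      then show "\<exists>a. (\<forall>k. a k \<in> cochain_space G (n - 1)) \<and> bounded (range a) \<and>
          ((\<lambda>k. X k - codiff n (a k)) \<longlongrightarrow> 0) U" using Y by blast
    qed
  qed
qed

section \<open>Asymptotic cohomology in terms of representing sequences\<close>

lemma ultra_codifferential_coset:
  assumes n: "n \<ge> 1"
  shows "ultra_codifferential G act U n (x +o nseqs U (n - 1)) = (codifferential G act n \<circ> x) +o nseqs U n"
proof -
  \<comment> \<open>Independence of the representative: null sequences go to null sequences, so the
    union in \<open>ultrapower_map\<close> is over equal cosets.\<close>
  have "(codifferential G act n \<circ> x') +o nseqs U n = (codifferential G act n \<circ> x) +o nseqs U n"
    if "x' \<in> x +o nseqs U (n - 1)" for x'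
  proof -
    have "x' - x \<in> nseqs U (n - 1)" using that by (rule set_plus_imp_minus)
    moreover have "codifferential G act n \<circ> (x' - x) = (codifferential G act n \<circ> x') - (codifferential G act n \<circ> x)"
      by (rule ext) (simp add: codifferential_diff[OF n])
    ultimately show ?thesis
      using codifferential_nseqs[OF n] by (metis coset_eq_iff[OF add_subgroup_nseqs])
  qed
  moreover have "x \<in> x +o nseqs U (n - 1)"
    using set_plus_intro2[OF add_subgroup_0[OF add_subgroup_nseqs], of x] by simp
  ultimately show ?thesis
    unfolding ultra_codifferential_def ultrapower_map_def by blast
qed

lemma asymptotic_cocycles_eq:
  "asymptotic_cocycles G act U n =
     {x +o nseqs U n | x. x \<in> bseqs n \<and> codifferential G act (n + 1) \<circ> x \<in> nseqs U (n + 1)}"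
proof -
  have "ultra_codifferential G act U (n + 1) (x +o nseqs U n) = nseqs U (n + 1) \<longleftrightarrow>
      codifferential G act (n + 1) \<circ> x \<in> nseqs U (n + 1)" for x
    using ultra_codifferential_coset[of "n + 1" U x] coset_eq_self_iff[OF add_subgroup_nseqs, of _ U "n + 1"]
    by (simp only: add_diff_cancel_right' le_add2)
  then show ?thesis
    unfolding asymptotic_cocycles_def ultrapower_def quotient_space_def by blast
qed

lemma asymptotic_coboundaries_eq:
  assumes n: "n \<ge> 1"
  shows "asymptotic_coboundaries G act U n = {(codifferential G act n \<circ> a) +o nseqs U n | a. a \<in> bseqs (n - 1)}"
  using n ultra_codifferential_coset[OF n, of U]
  by (auto simp: asymptotic_coboundaries_def ultrapower_def quotient_space_def image_iff)

lemma asymptotic_cohomology_vanishes_iff: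
  assumes n: "n \<ge> 1"
  shows "asymptotic_cohomology_vanishes G act U n \<longleftrightarrow>
    (\<forall>x\<in>bseqs n. codifferential G act (n + 1) \<circ> x \<in> nseqs U (n + 1) \<longrightarrow>
       (\<exists>a\<in>bseqs (n - 1). x - (codifferential G act n \<circ> a) \<in> nseqs U n))"
proof -
  let ?d = "\<lambda>a. codifferential G act n \<circ> a"
  let ?Z = "asymptotic_cocycles G act U n" and ?B = "asymptotic_coboundaries G act U n"
  note N = add_subgroup_nseqs[of U n] and A = add_subgroup_bseqs[of "n - 1"]
  note Zeq = asymptotic_cocycles_eq[of U n] and Beq = asymptotic_coboundaries_eq[OF n, of U]
  have d_add: "?d a + ?d b = ?d (a + b)" and d_0: "?d 0 = 0" for a b
    by (rule ext, simp add: codifferential_add[OF n] codifferential_0[OF n])+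
  have "quotient_space ?Z ?B = {?B} \<longleftrightarrow> ?Z \<subseteq> ?B"
  \<comment> \<open>The elements being added are cosets, and their neutral element is the class of
    the null sequences.\<close>
  proof (rule quotient_space_eq_singleton_iff[where e = "nseqs U n"])
    show "nseqs U n \<in> ?B"
      unfolding Beq using add_subgroup_0[OF A] by (intro CollectI exI[of _ 0]) (simp only: d_0 set_zero_plus simp_thms)
    show "X + nseqs U n = X" if "X \<in> ?Z" for X
    proof -
      obtain x where "X = x +o nseqs U n" using \<open>X \<in> ?Z\<close> unfolding Zeq by blast
      then show ?thesis using coset_plus_coset[OF N, of x 0] by simp
    qed
    show "X + Y \<in> ?B" if "X \<in> ?B" "Y \<in> ?B" for X Y
    proof -
      obtain a b where ab: "a \<in> bseqs (n - 1)" "X = ?d a +o nseqs U n" "b \<in> bseqs (n - 1)" "Y = ?d b +o nseqs U n"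
        using \<open>X \<in> ?B\<close> \<open>Y \<in> ?B\<close> unfolding Beq by blast
      then have "X + Y = ?d (a + b) +o nseqs U n" by (simp only: coset_plus_coset[OF N] d_add)
      then show ?thesis unfolding Beq using add_subgroup_add[OF A ab(1,3)] by blast
    qed
    show "\<exists>Y\<in>?B. X + Y = nseqs U n" if X: "X \<in> ?B" for X
    proof -
      obtain a where a: "a \<in> bseqs (n - 1)" "X = ?d a +o nseqs U n" using X unfolding Beq by blast
      have "X + (?d (- a) +o nseqs U n) = nseqs U n"
        unfolding a(2) coset_plus_coset[OF N] d_add by (simp add: d_0)
      moreover have "?d (- a) +o nseqs U n \<in> ?B" unfolding Beq using add_subgroup_uminus[OF A a(1)] by blast
      ultimately show ?thesis by blast
    qed
    show "?B \<subseteq> ?Z"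
    proof
      fix X assume "X \<in> ?B"
      then obtain a where a: "a \<in> bseqs (n - 1)" "X = ?d a +o nseqs U n" unfolding Beq by blast
      have "codifferential G act (n + 1) \<circ> ?d a = 0"
        by (rule ext) (simp add: codifferential_codifferential[OF n, simplified])
      then have "codifferential G act (n + 1) \<circ> ?d a \<in> nseqs U (n + 1)"
        by (simp only: add_subgroup_0[OF add_subgroup_nseqs])
      then show "X \<in> ?Z"
        unfolding Zeq using a(2) codifferential_bseqs[OF n a(1)] by blast
    qed
  qed
  also have "?Z \<subseteq> ?B \<longleftrightarrow> (\<forall>x\<in>bseqs n. codifferential G act (n + 1) \<circ> x \<in> nseqs U (n + 1) \<longrightarrow>
       (\<exists>a\<in>bseqs (n - 1). x +o nseqs U n = ?d a +o nseqs U n))"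
    unfolding Zeq Beq by blast
  finally show ?thesis
    unfolding asymptotic_cohomology_vanishes_def asymptotic_cohomology_def coset_eq_iff[OF N] .
qed

lemma bounded_cohomology_vanishes_iff_image_eq_kernel:
  assumes n: "n \<ge> 1"
  shows "bounded_cohomology_vanishes G act n \<longleftrightarrow>
    codiff n ` cochain_space G (n - 1) = {F \<in> cochain_space G n. codiff (n + 1) F = 0}"
    (is "_ \<longleftrightarrow> ?B = ?Z")
proof -
  have inj: "inj of_bcf" by (auto intro: injI of_bcf_eqD)
  have "bounded_cohomology_vanishes G act n \<longleftrightarrow> bounded_coboundaries G act n = bounded_cocycles G act n"
    unfolding bounded_cohomology_vanishes_iff[OF n] using coboundaries_subset_cocycles[OF n] by blast
  also have "\<dots> \<longleftrightarrow> ?B = ?Z"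
    unfolding of_bcf_image_codiff[OF n, symmetric] of_bcf_kernel_codiff[symmetric]
    by (rule inj_image_eq_iff[OF inj])
  finally show ?thesis .
qed

end

section \<open>The ultrafilter and the conclusion\<close>

lemma nonprincipal_ultrafilter_le_sequentially:
  assumes "nonprincipal_ultrafilter U"
  shows "U \<le> sequentially"
proof -
  have ne: "\<forall>\<^sub>F i in U. i \<noteq> k" for k
    using assms unfolding nonprincipal_ultrafilter_def by blast
  \<comment> \<open>Each final segment is a finite intersection of complements of singletons, all of
    which belong to \<open>U\<close>.\<close>
  have "\<forall>\<^sub>F i in U. m \<le> i" for m
  proof (induction m)
    case (Suc m)
    with ne[of m] show ?case by eventually_elim simp
  qed simp
  then have "\<forall>\<^sub>F i in U. P i" if "\<forall>i\<ge>m. P i" for P m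
    using eventually_mono[OF \<open>\<forall>\<^sub>F i in U. m \<le> i\<close>] that by blast
  then show ?thesis by (auto simp: le_filter_def eventually_sequentially)
qed

theorem theoremB:
  fixes G :: "('g, 'm) monoid_scheme"
    and act :: "'g \<Rightarrow> 'e::banach \<Rightarrow> 'e"
    and U :: "nat filter"
    and n :: nat
  assumes "banach_module G act"
    and "nonprincipal_ultrafilter U"
    and "n \<ge> 1"
  shows "asymptotic_cohomology_vanishes G act U n \<longleftrightarrow>
    bounded_cohomology_vanishes G act n \<and>
    Hausdorff_space (bounded_cohomology_topology G act (n + 1))"
proof -
  interpret banach_module G act by fact
  let ?A = "cochain_space G (n - 1)" and ?B = "cochain_space G n"
  have n1: "n + 1 \<ge> 1" by simp
  note S = bounded_linear_codiff[OF assms(3)] and T = bounded_linear_codiff[OF n1]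
  note sub = subspace_cochain_space closed_cochain_space
  note sub_ker = image_codiff_subset_kernel[OF assms(3)]
  have U: "U \<noteq> bot" "U \<le> sequentially"
    using assms(2) nonprincipal_ultrafilter_le_sequentially by (auto simp: nonprincipal_ultrafilter_def)
  have "asymptotic_cohomology_vanishes G act U n \<longleftrightarrow> ultra_exact U (codiff n) (codiff (n + 1)) ?A ?B"
    unfolding asymptotic_cohomology_vanishes_iff[OF assms(3)] ultra_exact_codiff_iff[OF assms(3)] ..
  also have "\<dots> \<longleftrightarrow> codiff n ` ?A = {F \<in> ?B. codiff (n + 1) F = 0} \<and> closed (codiff (n + 1) ` ?B)"
    using exact_if_ultra_exact[OF S T sub sub sub_ker U] ultra_exact_if_exact[OF S T sub sub] by blast
  \<comment> \<open>The closed image is that of the codifferential of degree \<open>n + 1\<close>,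
    whose domain has degree \<open>n + 1 - 1 = n\<close>; it therefore governs the topology of the
    cohomology one degree higher.\<close>
  also have "\<dots> \<longleftrightarrow> bounded_cohomology_vanishes G act n \<and> Hausdorff_space (bounded_cohomology_topology G act (n + 1))"
    using bounded_cohomology_vanishes_iff_image_eq_kernel[OF assms(3)] Hausdorff_bounded_cohomology_iff_closed[OF n1]
    by simp
  finally show ?thesis .
qed

end
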